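(* Let $d\ge 1$ and let $(C_i)_i$ be a family of (finitely or) countably many compact sets in $\mathbb{R}^d$, where $C_i$ has thickness $\tau_i:=\tau(C_i)>0$, such that: (i) $\sup_i \operatorname{diam}(C_i)<+\infty$; (ii) there is a ball $B$ such that $B\cap E_i=\emptyset$ for every $i$, where $E_i$ is the unbounded component of the complement $\mathbb{R}^d\setminus C_i$ (the union of the two unbounded components when $d=1$); (iii) there exists $c\in(0,d)$ such that $$\sum_i \tau_i^{-c}\le \frac{1}{K_2}\,\beta^c\,(1-\beta^{d-c}),\qquad\text{where}\quad \beta:=\min\Big\{\frac14,\ \frac{\operatorname{diam}(B)}{\sup_i\operatorname{diam}(C_i)}\Big\}.$$ Then $$\dim_H\Big(B\cap\bigcap_i C_i\Big)\ \ge\ d-K_1\,\frac{\big(\sum_i\tau_i^{-c}\big)^{d/c}}{\beta^d\,|\log(\beta)|}\ >\ 0 .$$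
   Context: $\dim_H$ denotes Hausdorff dimension, $\operatorname{dist}$ the usual Euclidean distance, $\log$ the natural logarithm. The constants are $$K_1:=\frac{2d(24\sqrt d)^d\log(16\sqrt d)}{1-2^{-d}},\qquad K_2:=\bigg(\frac{(24\sqrt d)^d(1+4^d\cdot 2)}{1-2^{-d}}\bigg)^2 .$$ Thickness in $\mathbb{R}^d$. For a compact set $C\subset\mathbb{R}^d$, let $(G_n)_n$ be the (at most countably many, possibly finitely many) bounded open path-connected components of $\mathbb{R}^d\setminus C$, ordered by non-increasing diameter (the order among equal diameters is irrelevant), and let $E$ be the unbounded open path-connected component of $\mathbb{R}^d\setminus C$ (when $d=1$, $E$ is the union of the two unbounded intervals). If $E$ is not the only component of $\mathbb{R}^d\setminus C$, the thickness of $C$ is $$\tau(C):=\inf_n\frac{\operatorname{dist}\big(G_n,\ \bigcup_{1\le i\le n-1}G_i\cup E\big)}{\operatorname{diam}(G_n)},$$ the infimum being over the index set of the $G_n$. If $E$ is the only component, $\tau(C):=+\infty$ when $C$ has non-empty interior and $\tau(C):=0$ when $C$ has empty interior. So $\tau(C)\in[0,+\infty]$, and $(+\infty)^{-c}=0$. *)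

theory Defs
  imports "HOL-Analysis.Analysis"
begin

definition hausdorff_content :: "real \<Rightarrow> real \<Rightarrow> 'a::metric_space set \<Rightarrow> ennreal" where
  "hausdorff_content s \<delta> A =
     (INF U \<in> {U :: nat \<Rightarrow> 'a set. A \<subseteq> (\<Union>j. U j) \<and> (\<forall>j. bounded (U j) \<and> diameter (U j) \<le> \<delta>)}.
        \<Sum>j. ennreal (if U j = {} then 0 else if s = 0 then 1 else diameter (U j) powr s))"
  (* Boundedness is required because diameter is a meaningless value on unbounded sets.
     The cases encode 0^0 = 1 for nonempty U j. *)

definition hausdorff_measure :: "real \<Rightarrow> 'a::metric_space set \<Rightarrow> ennreal" where
  "hausdorff_measure s A = (SUP \<delta>\<in>{0<..}. hausdorff_content s \<delta> A)"

definition hausdorff_dim :: "'a::metric_space set \<Rightarrow> ereal" where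
  "hausdorff_dim A = (INF s\<in>{s. 0 \<le> s \<and> hausdorff_measure s A = 0}. ereal s)"

definition gaps :: "'a::euclidean_space set \<Rightarrow> 'a set set" where
  "gaps C = {path_component_set (- C) x | x. x \<notin> C \<and> bounded (path_component_set (- C) x)}"

lemma gapsD:
  assumes "D \<in> gaps C"
  shows "D \<noteq> {} \<and> bounded D"
proof -
  obtain x where D: "D = path_component_set (- C) x" and x: "x \<notin> C" and b: "bounded D"
    using assms unfolding gaps_def by blast
  have "x \<in> D" using x unfolding D by (simp add: path_component_refl)
  then show ?thesis using b by blast
qed

definition exterior :: "'a::euclidean_space set \<Rightarrow> 'a set" where
  "exterior C = {x. x \<notin> C \<and> \<not> bounded (path_component_set (- C) x)}"
  (* The union of all unbounded components: exactly one component if C is compact and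
     the dimension is at least 2, the two unbounded intervals in dimension 1. *)

lemma exterior_eq_outside: "closed C \<Longrightarrow> exterior C = outside C"
  by (auto simp: exterior_def outside_def open_path_connected_component open_Compl)

definition gap_enumeration :: "'a::euclidean_space set \<Rightarrow> nat set \<Rightarrow> (nat \<Rightarrow> 'a set) \<Rightarrow> bool" where
  "gap_enumeration C N G \<longleftrightarrow>
     (N = {1..} \<or> (\<exists>k. N = {1..k})) \<and> bij_betw G N (gaps C) \<and>
     (\<forall>m\<in>N. \<forall>n\<in>N. m \<le> n \<longrightarrow> diameter (G n) \<le> diameter (G m))"

definition enumerated_thickness :: "'a::euclidean_space set \<Rightarrow> nat set \<Rightarrow> (nat \<Rightarrow> 'a set) \<Rightarrow> ennreal" where
  "enumerated_thickness C N G =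
     (INF n\<in>N. ennreal (setdist (G n) ((\<Union>i\<in>{1..<n}. G i) \<union> exterior C) / diameter (G n)))"

definition thickness :: "'a::euclidean_space set \<Rightarrow> ennreal" where
  "thickness C =
     (if gaps C = {} then (if interior C = {} then 0 else \<infinity>)
      else if \<exists>N G. gap_enumeration C N G
        then (SOME t. \<exists>N G. gap_enumeration C N G \<and> t = enumerated_thickness C N G)
      else 0)"
  (* The value does not depend on the enumeration chosen by SOME, see thickness_eq below.
     In dimension at least 2 a compact C can have infinitely many gaps of diameter
     at least some e > 0 (thin parallel slots, say), and then possibly no enumeration with
     non-increasing diameters. Two such gaps are arbitrarily close to each other,
     so the quotients of distance and diameter have infimum 0 in whatever order they are taken;
     hence the last case. *)

lemma enumerated_thickness_le_pair:
  assumes G: "gap_enumeration C N G" and A: "A \<in> gaps C" "A' \<in> gaps C" "A \<noteq> A'"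
    and diam: "diameter A \<le> diameter A'"
  shows "enumerated_thickness C N G \<le> ennreal (setdist A A' / diameter A)"
proof -
  let ?X = "\<lambda>n. (\<Union>i\<in>{1..<n}. G i) \<union> exterior C"
  have le: "enumerated_thickness C N G \<le> ennreal (setdist (G k) (?X k) / diameter (G k))"
    if "k \<in> N" for k
    unfolding enumerated_thickness_def by (rule INF_lower[OF that])
  have N: "1 \<le> n" if "n \<in> N" for n
    using G that by (auto simp: gap_enumeration_def)
  have ne: "D \<noteq> {}" if "D \<in> gaps C" for D
    using gapsD[OF that] by blast
  have bdd: "bounded D" if "D \<in> gaps C" for D
    using gapsD[OF that] by blast
  have "G ` N = gaps C"
    using G by (auto simp: gap_enumeration_def bij_betw_def)
  then obtain a b where a: "a \<in> N" "A = G a" and b: "b \<in> N" "A' = G b"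
    using A by (metis imageE)
  have sub: "ennreal (setdist (G m) (?X m) / diameter (G m)) \<le> ennreal (setdist (G m) (G n) / diameter (G m))"
    if "n < m" "n \<in> N" "G n \<in> gaps C" "G m \<in> gaps C" for m n
  proof (intro ennreal_leI divide_right_mono setdist_subset_right diameter_ge_0)
    show "G n \<subseteq> ?X m" using that N[of n] by auto
  qed (use that ne bdd in auto)
  show ?thesis
  proof (cases "b < a")
    case True
    then show ?thesis using le[OF a(1)] sub[of b a] a b A by (metis order_trans)
  next
    case False
    then have "a < b" using a b A by (cases a b rule: linorder_cases) auto
    moreover have "diameter A' \<le> diameter A"
      using G a b \<open>a < b\<close> by (auto simp: gap_enumeration_def)
    ultimately show ?thesis
      using le[OF b(1)] sub[of a b] a b A diam by (metis order_antisym order_trans setdist_sym)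
  qed
qed

lemma enumerated_thickness_le:
  fixes C :: "'a::euclidean_space set"
  assumes C: "compact C" and G: "gap_enumeration C N G" and H: "gap_enumeration C M H"
  shows "enumerated_thickness C N G \<le> enumerated_thickness C M H"
  unfolding enumerated_thickness_def[of C M H]
proof (rule INF_greatest)
  fix m assume m: "m \<in> M"
  let ?t = "enumerated_thickness C N G" and ?A = "H m"
  let ?Y = "(\<Union>i\<in>{1..<m}. H i) \<union> exterior C"
  have ext: "exterior C \<noteq> {}"
    using exterior_eq_outside[OF compact_imp_closed[OF C]]
      outside_bounded_nonempty[OF compact_imp_bounded[OF C]] by simp
  have gN: "G ` N = gaps C" and hM: "H ` M = gaps C" and inj: "inj_on H M"
    using G H by (auto simp: gap_enumeration_def bij_betw_def)
  have A: "?A \<in> gaps C" using m hM by auto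
  then obtain n where n: "n \<in> N" "G n = ?A" using gN by (metis imageE)
  have ne: "?A \<noteq> {}" and "bounded ?A"
    using gapsD[OF A] by blast+
  then have d0: "0 \<le> diameter ?A" by (simp add: diameter_ge_0)
  have "?t \<le> ennreal (setdist ?A ((\<Union>i\<in>{1..<n}. G i) \<union> exterior C) / diameter ?A)"
    unfolding enumerated_thickness_def n(2)[symmetric] by (rule INF_lower[OF n(1)])
  also have "\<dots> \<le> ennreal (setdist ?A (exterior C) / diameter ?A)"
    by (intro ennreal_leI divide_right_mono setdist_subset_right d0 ext) auto
  finally have tE: "?t \<le> ennreal (setdist ?A (exterior C) / diameter ?A)" .
  have tH: "?t \<le> ennreal (setdist ?A (H i) / diameter ?A)" if "i \<in> {1..<m}" for i
  proof (rule enumerated_thickness_le_pair[OF G A])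
    have i: "i \<in> M" using that m H by (auto simp: gap_enumeration_def)
    then show "H i \<in> gaps C" using hM by auto
    show "H m \<noteq> H i" using inj i m that by (auto dest: inj_onD)
    show "diameter (H m) \<le> diameter (H i)"
      using H i m that by (auto simp: gap_enumeration_def)
  qed
  show "?t \<le> ennreal (setdist ?A ?Y / diameter ?A)"
  proof (cases "diameter ?A = 0")
    case True
    then show ?thesis using tE by simp
  next
    case False
    then have d: "0 < diameter ?A" using d0 by simp
    obtain t where t: "0 \<le> t" "?t = ennreal t"
      using tE by (cases ?t) (auto simp: top_unique)
    have *: "t * diameter ?A \<le> setdist ?A Z" if "?t \<le> ennreal (setdist ?A Z / diameter ?A)" for Z
      using that t d by (simp add: pos_le_divide_eq)
    have "t * diameter ?A \<le> setdist ?A ?Y"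
    proof (rule le_setdistI)
      fix x y assume x: "x \<in> ?A" and "y \<in> ?Y"
      then obtain Z where "y \<in> Z" "?t \<le> ennreal (setdist ?A Z / diameter ?A)"
        using tE tH by blast
      then show "t * diameter ?A \<le> dist x y"
        using * setdist_le_dist[OF x] by (meson order_trans)
    qed (use ne ext in auto)
    then show ?thesis
      using t d by (simp add: pos_le_divide_eq ennreal_leI)
  qed
qed

lemma thickness_eq:
  fixes C :: "'a::euclidean_space set"
  assumes "compact C" "gaps C \<noteq> {}" "gap_enumeration C N G"
  shows "thickness C = enumerated_thickness C N G"
proof -
  let ?P = "\<lambda>t. \<exists>N G. gap_enumeration C N G \<and> t = enumerated_thickness C N G"
  have "?P (SOME t. ?P t)"
    by (rule someI_ex) (use assms in blast)
  moreover have "thickness C = (SOME t. ?P t)"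
    using assms by (auto simp: thickness_def)
  ultimately show ?thesis
    using enumerated_thickness_le[OF assms(1)] assms(3) by (metis order_antisym)
qed

definition inv_powr :: "ennreal \<Rightarrow> real \<Rightarrow> real" where
  "inv_powr t c = (if t = \<infinity> then 0 else enn2real t powr (- c))"

definition K1 :: "nat \<Rightarrow> real" where
  "K1 d = 2 * real d * (24 * sqrt (real d)) ^ d * ln (16 * sqrt (real d)) / (1 - 1 / 2 ^ d)"

definition K2 :: "nat \<Rightarrow> real" where
  "K2 d = ((24 * sqrt (real d)) ^ d * (1 + 4 ^ d * 2) / (1 - 1 / 2 ^ d))\<^sup>2"

end

theory Submission
  imports Defs
begin

text \<open>
  Let \<open>d\<close> be the dimension and \<open>D\<close> the supremum of the diameters of
  the sets. Since \<open>B\<close> misses the exteriors, the intersection contains every point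
  of \<open>B\<close> that lies in no gap. So the gaps of all the sets have to be removed from a
  cube \<open>Q\<close> of side \<open>s\<close> inside \<open>B\<close>, and the remaining set
  has to be large.

  If \<open>C\<close> has thickness \<open>\<tau>\<close>, two gaps of \<open>C\<close> are at
  distance at least \<open>\<tau>\<close> times the smaller diameter, and \<open>\<tau>\<close>
  times the diameter of a gap is at most \<open>D\<close> (\<open>thickness_gap_bounds\<close>).
  Subdivide \<open>Q\<close> dyadically into cells of side \<open>s / 2 ^ n\<close>, and assign
  a gap \<open>G\<close> to the first level at which the diameter of the cells is less than
  \<open>\<tau>\<close> times the diameter of \<open>G\<close>. Then a cell meets at most one
  gap of its own level from each set, and at level \<open>n \<ge> 1\<close> this gap has
  diameter at most \<open>2 * sqrt d * (s / 2 ^ n) / \<tau>\<close>. Hence the sum of the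
  \<open>c\<close>-th powers of the diameters of these gaps is at most \<open>S * (2 * sqrt d *
  (s / 2 ^ n)) powr c\<close>.

  Call a cell low if the sum of the \<open>c\<close>-th powers of the diameters of the gaps of
  its own or a smaller level that meet it is at most \<open>(s / 2 ^ n / 24) powr c\<close>. The
  smallness of \<open>S\<close> makes \<open>Q\<close> low. A count with weights shows that at
  least half of the \<open>2 ^ (N * d)\<close> subcells lying \<open>N\<close> levels below a
  low cell are low again, as long as \<open>N * S powr (d / c)\<close> is at most a constant
  depending on \<open>d\<close> and \<open>N\<close> is not too small
  (\<open>card_not_low\<close>). Iteration yields a Cantor set in which each cell has \<open>2 ^
  (N * d - 1)\<close> successors of side \<open>2 ^ N\<close> times smaller. It avoids the gaps,
  since a gap meeting low cells of all levels would have diameter 0. By the mass distribution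
  principle its dimension is at least \<open>d - 1 / N\<close>
  (\<open>hausdorff_dim_ge\<close>).

  Choosing \<open>N\<close> of the order of \<open>S powr (- d / c)\<close> gives the claim.
  Treating that many levels at once is what produces the exponent \<open>d / c\<close>: the gaps
  of one level remove a proportion of order \<open>S powr (d / c)\<close> of the volume, and the
  removal of half of the cells costs dimension \<open>1 / N\<close>. The case \<open>S =
  0\<close> is obtained by letting \<open>N\<close> tend to infinity.
\<close>

section \<open>Gaps and thickness\<close>

lemma dist_convex_hull_le_diameter:
  fixes C :: "'a::euclidean_space set"
  assumes "bounded C" "y \<in> convex hull C" "z \<in> convex hull C"
  shows "dist y z \<le> diameter C"
proof -
  have 1: "convex hull C \<subseteq> cball w (diameter C)" if "w \<in> C" for w
    using diameter_bounded_bound[OF assms(1) that] by (intro hull_minimal) auto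
  then have "C \<subseteq> cball y (diameter C)" using assms(2) by (fastforce simp: dist_commute)
  then have "convex hull C \<subseteq> cball y (diameter C)" by (intro hull_minimal) auto
  then show ?thesis using assms(3) by auto
qed

lemma not_exterior_imp_convex_hull:
  fixes C :: "'a::euclidean_space set"
  assumes "closed C" "y \<notin> exterior C"
  shows "y \<in> convex hull C"
proof -
  have "outside (convex hull C) \<subseteq> exterior C"
    unfolding exterior_eq_outside[OF assms(1)] by (intro outside_mono hull_subset)
  moreover have "outside (convex hull C) = - (convex hull C)" by (intro outside_convex convex_convex_hull)
  ultimately show ?thesis using assms(2) by blast
qed

lemma gap_disjoint_exterior:
  assumes "G \<in> gaps C"
  shows "G \<inter> exterior C = {}"
proof -
  obtain x where G: "G = path_component_set (- C) x" "bounded G"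
    using assms by (auto simp: gaps_def)
  have "bounded (path_component_set (- C) y)" if "y \<in> G" for y
    using that G path_component_eq[of y "- C" x] by auto
  then show ?thesis by (auto simp: exterior_def)
qed

lemma gap_diameter_pos:
  fixes C :: "'a::euclidean_space set"
  assumes "closed C" "G \<in> gaps C"
  shows "0 < diameter G"
proof -
  have "open G" using assms by (auto simp: gaps_def open_path_component open_Compl)
  moreover obtain x where x: "x \<in> G" using gapsD[OF assms(2)] by blast
  ultimately obtain e where e: "0 < e" "cball x e \<subseteq> G"
    by (metis open_contains_cball)
  have "diameter (cball x e) \<le> diameter G"
    using gapsD[OF assms(2)] e by (intro diameter_subset) auto
  then show ?thesis using e by simp
qed

lemma not_exterior_imp_gap:
  assumes "y \<notin> C" "y \<notin> exterior C"
  shows "\<exists>G\<in>gaps C. y \<in> G"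
proof -
  have "path_component_set (- C) y \<in> gaps C" using assms by (auto simp: gaps_def exterior_def)
  moreover have "y \<in> path_component_set (- C) y" using assms by (simp add: path_component_refl)
  ultimately show ?thesis by blast
qed

lemma gap_subset_convex_hull:
  fixes C :: "'a::euclidean_space set"
  assumes "closed C" "G \<in> gaps C"
  shows "G \<subseteq> convex hull C"
  using not_exterior_imp_convex_hull[OF assms(1)] gap_disjoint_exterior[OF assms(2)] by blast

text \<open>
  A gap lies in the convex hull of \<open>C\<close>, which has the diameter of \<open>C\<close>;
  so every point farther than that from a point of the gap is exterior.
\<close>

lemma setdist_gap_exterior_le:
  fixes C :: "'a::euclidean_space set"
  assumes "compact C" "G \<in> gaps C"
  shows "setdist G (exterior C) \<le> diameter C"
proof (rule field_le_epsilon)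
  fix e :: real assume e: "0 < e"
  have C: "bounded C" "closed C" using assms by (auto simp: compact_imp_bounded compact_imp_closed)
  obtain y where y: "y \<in> G" using gapsD[OF assms(2)] by blast
  obtain b :: 'a where b: "b \<in> Basis" by (meson nonempty_Basis ex_in_conv)
  define z where "z = y + (diameter C + e) *\<^sub>R b"
  have "0 \<le> diameter C" by (rule diameter_ge_0[OF C(1)])
  then have d: "dist y z = diameter C + e" using b e by (simp add: z_def dist_norm)
  then have "z \<notin> convex hull C"
    using dist_convex_hull_le_diameter[OF C(1), of y z] gap_subset_convex_hull[OF C(2) assms(2)] y e by auto
  then have "z \<in> exterior C" using not_exterior_imp_convex_hull[OF C(2)] by blast
  then show "setdist G (exterior C) \<le> diameter C + e" using setdist_le_dist[OF y] d by metis
qed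

text \<open>
  All that the argument needs to know about thickness. A positive thickness
  \<open>\<tau>\<close> of a set with gaps is finite, because the distance of a gap to the
  exterior is at most the diameter of \<open>C\<close>; the same bound controls the size of the
  gaps. Two gaps are at distance at least \<open>\<tau>\<close> times the smaller diameter.
\<close>

lemma thickness_gap_bounds:
  fixes C :: "'a::euclidean_space set"
  assumes C: "compact C" and pos: "0 < thickness C" and ne: "gaps C \<noteq> {}"
  shows "\<exists>\<tau>>0. thickness C = ennreal \<tau> \<and>
    (\<forall>G\<in>gaps C. \<tau> * diameter G \<le> diameter C) \<and>
    (\<forall>G\<in>gaps C. \<forall>G'\<in>gaps C. G \<noteq> G' \<longrightarrow> diameter G \<le> diameter G' \<longrightarrow> \<tau> * diameter G \<le> setdist G G')"
proof -
  have cl: "closed C" using C by (rule compact_imp_closed)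
  obtain N F where NF: "gap_enumeration C N F"
    using pos ne by (auto simp: thickness_def split: if_splits)
  have eq: "thickness C = enumerated_thickness C N F" by (rule thickness_eq[OF C ne NF])
  have im: "F ` N = gaps C" and N1: "\<And>n. n \<in> N \<Longrightarrow> 1 \<le> n"
    using NF by (auto simp: gap_enumeration_def bij_betw_def)
  have ext: "exterior C \<noteq> {}"
    using exterior_eq_outside[OF cl] outside_bounded_nonempty[OF compact_imp_bounded[OF C]] by simp
  have E: "thickness C \<le> ennreal (diameter C / diameter G)" if G: "G \<in> gaps C" for G
  proof -
    obtain n where n: "n \<in> N" "F n = G" using im G by (metis imageE)
    have "thickness C \<le> ennreal (setdist (F n) ((\<Union>i\<in>{1..<n}. F i) \<union> exterior C) / diameter (F n))"
      unfolding eq enumerated_thickness_def by (rule INF_lower[OF n(1)])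
    also have "\<dots> \<le> ennreal (diameter C / diameter G)"
    proof (intro ennreal_leI)
      have "setdist G ((\<Union>i\<in>{1..<n}. F i) \<union> exterior C) \<le> setdist G (exterior C)"
        by (rule setdist_subset_right) (use ext in auto)
      also have "\<dots> \<le> diameter C" by (rule setdist_gap_exterior_le[OF C G])
      finally show "setdist (F n) ((\<Union>i\<in>{1..<n}. F i) \<union> exterior C) / diameter (F n) \<le> diameter C / diameter G"
        using gap_diameter_pos[OF cl G] n by (auto intro: divide_right_mono)
    qed
    finally show ?thesis .
  qed
  obtain G0 where "G0 \<in> gaps C" using ne by blast
  then have "thickness C \<noteq> \<infinity>" using E[of G0] by (metis ennreal_neq_top infinity_ennreal_def top_unique)
  then obtain \<tau> where \<tau>: "thickness C = ennreal \<tau>" "0 \<le> \<tau>" by (cases "thickness C") auto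
  show ?thesis
  proof (intro exI[of _ \<tau>] conjI ballI impI)
    show "0 < \<tau>" using pos \<tau> by (simp add: ennreal_less_zero_iff)
    show "thickness C = ennreal \<tau>" by (rule \<tau>(1))
    show "\<tau> * diameter G \<le> diameter C" if G: "G \<in> gaps C" for G
      using E[OF G] gap_diameter_pos[OF cl G] \<tau> diameter_ge_0[OF compact_imp_bounded[OF C]]
      by (simp add: pos_le_divide_eq)
    show "\<tau> * diameter G \<le> setdist G G'"
      if "G \<in> gaps C" "G' \<in> gaps C" "G \<noteq> G'" "diameter G \<le> diameter G'" for G G'
      using enumerated_thickness_le_pair[OF NF that] gap_diameter_pos[OF cl that(1)] \<tau> eq
      by (simp add: pos_le_divide_eq)
  qed
qed

section \<open>Dyadic cells\<close>

text \<open>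
  The values of a linear functional on a bounded set lie in an interval whose length is governed
  by the diameter (an interval centred at the image of a point of \<open>U\<close> would be
  twice as long).
\<close>

lemma coordinate_range:
  fixes U :: "'a::euclidean_space set"
  assumes "bounded U"
  shows "\<exists>l. \<forall>y\<in>U. l \<le> y \<bullet> b \<and> y \<bullet> b \<le> l + norm b * diameter U"
proof (cases "U = {}")
  case True
  then show ?thesis by simp
next
  case False
  have close: "y \<bullet> b - norm b * diameter U \<le> z \<bullet> b" if "y \<in> U" "z \<in> U" for y z
  proof -
    have "y \<bullet> b - z \<bullet> b \<le> norm (y - z) * norm b"
      using norm_cauchy_schwarz[of "y - z" b] by (simp add: inner_diff_left)
    also have "norm (y - z) * norm b \<le> diameter U * norm b"
      using diameter_bounded_bound[OF assms that] by (intro mult_right_mono) (auto simp: dist_norm)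
    finally show ?thesis by (simp add: mult.commute)
  qed
  obtain y0 where y0: "y0 \<in> U" using False by blast
  define l where "l = Inf ((\<lambda>y. y \<bullet> b) ` U)"
  have bdd: "bdd_below ((\<lambda>y. y \<bullet> b) ` U)"
    using close[OF y0] by (intro bdd_belowI2) auto
  have "l \<le> y \<bullet> b \<and> y \<bullet> b \<le> l + norm b * diameter U" if y: "y \<in> U" for y
  proof
    show "l \<le> y \<bullet> b" unfolding l_def by (rule cINF_lower[OF bdd y])
    have "y \<bullet> b - norm b * diameter U \<le> l"
      unfolding l_def by (rule cINF_greatest[OF False]) (use close y in auto)
    then show "y \<bullet> b \<le> l + norm b * diameter U" by simp
  qed
  then show ?thesis by blast
qed

lemma card_int_interval_le:
  fixes l h :: real
  assumes "l \<le> h + 1"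
  shows "real (card {k::int. l \<le> k \<and> k \<le> h}) \<le> h - l + 1" and "finite {k::int. l \<le> k \<and> k \<le> h}"
proof -
  have eq: "{k::int. l \<le> k \<and> k \<le> h} = {\<lceil>l\<rceil>..\<lfloor>h\<rfloor>}"
    by (auto simp: ceiling_le_iff le_floor_iff)
  show "finite {k::int. l \<le> k \<and> k \<le> h}" unfolding eq by simp
  have "real (nat (\<lfloor>h\<rfloor> + 1 - \<lceil>l\<rceil>)) \<le> h - l + 1"
    using assms le_of_int_ceiling[of l] of_int_floor_le[of h] by linarith
  then have "real (card {\<lceil>l\<rceil>..\<lfloor>h\<rfloor>}) \<le> h - l + 1" by simp
  then show "real (card {k::int. l \<le> k \<and> k \<le> h}) \<le> h - l + 1" unfolding eq .
qed

text \<open>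
  The closed dyadic cube of side \<open>s / 2 ^ n\<close> with integer coordinates
  \<open>v\<close> in the grid with origin \<open>a\<close>. Only the values of \<open>v\<close>
  on the basis matter; coordinate functions are kept extensional on the basis, so that different
  coordinate functions belong to different cubes.
\<close>

definition cell :: "'a::euclidean_space \<Rightarrow> real \<Rightarrow> nat \<Rightarrow> ('a \<Rightarrow> int) \<Rightarrow> 'a set" where
  "cell a s n v =
     {y. \<forall>b\<in>Basis. s / 2 ^ n * v b \<le> (y - a) \<bullet> b \<and> (y - a) \<bullet> b \<le> s / 2 ^ n * (v b + 1)}"

text \<open>
  The coordinates of the \<open>2 ^ (k * DIM('a))\<close> cubes that are \<open>k\<close> levels
  below the cube with coordinates \<open>v\<close>. Neither the level nor the grid enters.
\<close>

definition subcells :: "nat \<Rightarrow> ('a::euclidean_space \<Rightarrow> int) \<Rightarrow> ('a \<Rightarrow> int) set" where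
  "subcells k v = PiE Basis (\<lambda>b. {2 ^ k * v b ..< 2 ^ k * (v b + 1)})"

lemma cell_eq_cbox:
  "cell a s n v = cbox (a + (\<Sum>b\<in>Basis. (s / 2 ^ n * v b) *\<^sub>R b)) (a + (\<Sum>b\<in>Basis. (s / 2 ^ n * (v b + 1)) *\<^sub>R b))"
  by (auto simp: cell_def mem_box inner_add_left inner_diff_left algebra_simps)

lemma compact_cell: "compact (cell a s n v)"
  by (simp add: cell_eq_cbox compact_cbox)

lemma cell_nonempty:
  assumes "0 < s"
  shows "cell a s n v \<noteq> {}"
  using assms by (auto simp: cell_eq_cbox box_ne_empty inner_add_left intro!: divide_right_mono mult_left_mono)

lemma dist_le_cell:
  fixes y :: "'a::euclidean_space"
  assumes "y \<in> cell a s n v" "z \<in> cell a s n v"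
  shows "dist y z \<le> sqrt (DIM('a)) * (s / 2 ^ n)"
proof -
  have "infnorm (y - z) \<le> s / 2 ^ n"
  proof -
    have "\<bar>(y - z) \<bullet> b\<bar> \<le> s / 2 ^ n" if "b \<in> Basis" for b
    proof -
      have "(y - z) \<bullet> b = (y - a) \<bullet> b - (z - a) \<bullet> b" by (simp add: inner_diff_left)
      moreover have "s / 2 ^ n * (v b + 1) = s / 2 ^ n * v b + s / 2 ^ n" by (simp add: algebra_simps add_divide_distrib)
      moreover have "s / 2 ^ n * v b \<le> (y - a) \<bullet> b" "(y - a) \<bullet> b \<le> s / 2 ^ n * (v b + 1)"
        "s / 2 ^ n * v b \<le> (z - a) \<bullet> b" "(z - a) \<bullet> b \<le> s / 2 ^ n * (v b + 1)"
        using assms that unfolding cell_def by blast+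
      ultimately show ?thesis by linarith
    qed
    then show ?thesis unfolding infnorm_Max by (subst Max_le_iff) auto
  qed
  then have "norm (y - z) \<le> sqrt (DIM('a)) * (s / 2 ^ n)"
    using norm_le_infnorm[of "y - z"] by (meson mult_left_mono order_trans real_sqrt_ge_zero of_nat_0_le_iff)
  then show ?thesis by (simp add: dist_norm)
qed

lemma finite_subcells: "finite (subcells k v)"
  unfolding subcells_def by (intro finite_PiE) auto

lemma card_subcells: "card (subcells k (v :: 'a::euclidean_space \<Rightarrow> int)) = 2 ^ (k * DIM('a))"
proof -
  have "nat (2 ^ k * (v b + 1) - 2 ^ k * v b) = 2 ^ k" for b
    by (simp add: algebra_simps nat_power_eq)
  then show ?thesis
    unfolding subcells_def by (subst card_PiE) (auto simp: power_mult nat_power_eq)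
qed

lemma cell_subcells_subset:
  assumes "0 < s" "w \<in> subcells k v"
  shows "cell a s (n + k) w \<subseteq> cell a s n v"
proof
  fix y assume y: "y \<in> cell a s (n + k) w"
  show "y \<in> cell a s n v" unfolding cell_def
  proof (intro CollectI ballI)
    fix b :: 'a assume b: "b \<in> Basis"
    then have "2 ^ k * v b \<le> w b" "w b + 1 \<le> 2 ^ k * (v b + 1)"
      using assms(2) by (auto simp: subcells_def PiE_def Pi_def)
    then have w: "(2 ^ k * v b :: real) \<le> w b" "w b + 1 \<le> (2 ^ k * (v b + 1) :: real)"
      by (metis of_int_le_iff of_int_mult of_int_numeral of_int_power,
          metis of_int_le_iff of_int_mult of_int_numeral of_int_power of_int_add of_int_1)
    have "s / 2 ^ n * v b = s / 2 ^ (n + k) * (2 ^ k * v b)"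
      by (simp add: power_add)
    also have "\<dots> \<le> s / 2 ^ (n + k) * w b" using w assms(1) by (intro mult_left_mono) auto
    also have "\<dots> \<le> (y - a) \<bullet> b" using y b by (auto simp: cell_def)
    finally have 1: "s / 2 ^ n * v b \<le> (y - a) \<bullet> b" .
    have "(y - a) \<bullet> b \<le> s / 2 ^ (n + k) * (w b + 1)" using y b by (auto simp: cell_def)
    also have "\<dots> \<le> s / 2 ^ (n + k) * (2 ^ k * (v b + 1))"
      using w assms(1) by (intro mult_left_mono) auto
    also have "\<dots> = s / 2 ^ n * (v b + 1)" by (simp add: power_add)
    finally show "s / 2 ^ n * v b \<le> (y - a) \<bullet> b \<and> (y - a) \<bullet> b \<le> s / 2 ^ n * (v b + 1)" using 1 by simp
  qed
qed

lemma subcells_add: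
  "w \<in> subcells (j + k) v \<longleftrightarrow> (\<exists>u\<in>subcells j v. w \<in> subcells k u)"
proof
  assume w: "w \<in> subcells (j + k) v"
  let ?u = "\<lambda>b\<in>Basis. w b div 2 ^ k"
  have quot: "2 ^ k * (w b div 2 ^ k) \<le> w b \<and> w b < 2 ^ k * (w b div 2 ^ k + 1)" for b
  proof -
    have "0 \<le> w b mod 2 ^ k" "w b mod 2 ^ k < 2 ^ k" by simp_all
    moreover have "2 ^ k * (w b div 2 ^ k) + w b mod 2 ^ k = w b" by (rule mult_div_mod_eq)
    ultimately show ?thesis unfolding distrib_left mult_1_right by linarith
  qed
  have "2 ^ j * v b \<le> w b div 2 ^ k \<and> w b div 2 ^ k < 2 ^ j * (v b + 1)" if "b \<in> Basis" for b
  proof -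
    have "2 ^ k * (2 ^ j * v b) \<le> w b" "w b < 2 ^ k * (2 ^ j * (v b + 1))"
      using w that by (auto simp: subcells_def PiE_def Pi_def power_add mult_ac)
    then have "2 ^ k * (2 ^ j * v b) < 2 ^ k * (w b div 2 ^ k + 1)"
      "2 ^ k * (w b div 2 ^ k) < 2 ^ k * (2 ^ j * (v b + 1))"
      using quot[of b] by linarith+
    then show ?thesis by (simp add: mult_less_cancel_left_pos)
  qed
  then have "?u \<in> subcells j v" by (auto simp: subcells_def)
  moreover have "w \<in> subcells k ?u"
    using w quot by (auto simp: subcells_def PiE_def Pi_def)
  ultimately show "\<exists>u\<in>subcells j v. w \<in> subcells k u" by blast
next
  assume "\<exists>u\<in>subcells j v. w \<in> subcells k u"
  then obtain u where u: "u \<in> subcells j v" "w \<in> subcells k u" by blast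
  have "2 ^ (j + k) * v b \<le> w b \<and> w b < 2 ^ (j + k) * (v b + 1)" if b: "b \<in> Basis" for b
  proof -
    have "2 ^ j * v b \<le> u b" "u b + 1 \<le> 2 ^ j * (v b + 1)" "2 ^ k * u b \<le> w b" "w b < 2 ^ k * (u b + 1)"
      using u b by (auto simp: subcells_def PiE_def Pi_def)
    moreover from this have "2 ^ k * (2 ^ j * v b) \<le> 2 ^ k * u b"
      "2 ^ k * (u b + 1) \<le> 2 ^ k * (2 ^ j * (v b + 1))"
      by (auto intro: mult_left_mono simp del: mult_le_cancel_left_pos)
    ultimately have "2 ^ k * (2 ^ j * v b) \<le> w b" "w b < 2 ^ k * (2 ^ j * (v b + 1))"
      by linarith+
    then show ?thesis by (simp add: power_add mult_ac)
  qed
  then show "w \<in> subcells (j + k) v" using u by (auto simp: subcells_def PiE_def Pi_def)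
qed

lemma subcells_parent_unique:
  assumes "w \<in> subcells k u" "w \<in> subcells k u'" "u \<in> extensional Basis" "u' \<in> extensional Basis"
  shows "u = u'"
proof (rule extensionalityI[OF assms(3,4)])
  fix b :: 'a assume b: "b \<in> Basis"
  have *: "2 ^ k * u b \<le> w b" "w b < 2 ^ k * (u b + 1)" "2 ^ k * u' b \<le> w b" "w b < 2 ^ k * (u' b + 1)"
    using assms b by (auto simp: subcells_def PiE_def Pi_def)
  have "2 ^ k * u b < 2 ^ k * (u' b + 1)" "2 ^ k * u' b < 2 ^ k * (u b + 1)" using * by linarith+
  then show "u b = u' b" by (simp add: mult_less_cancel_left_pos)
qed

lemma subcells_extensional: "w \<in> subcells k v \<Longrightarrow> w \<in> extensional Basis"
  by (auto simp: subcells_def PiE_def)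

text \<open>
  In each coordinate the closed cells of side \<open>t\<close> meeting a set of diameter
  \<open>g\<close> have at most \<open>g / t + 2\<close> values.
\<close>

lemma card_cells_meeting:
  fixes U :: "'a::euclidean_space set"
  assumes s: "0 < s" and U: "bounded U"
    and W_def: "W = {w \<in> extensional Basis. U \<inter> cell a s n w \<noteq> {}}"
  shows "finite W" and "real (card W) \<le> (diameter U / (s / 2 ^ n) + 2) ^ DIM('a)"
proof -
  have "\<forall>b. \<exists>l. \<forall>y\<in>U. l \<le> y \<bullet> b \<and> y \<bullet> b \<le> l + norm b * diameter U"
    by (rule allI) (rule coordinate_range[OF U])
  then obtain l where "\<forall>b. \<forall>y\<in>U. l b \<le> y \<bullet> b \<and> y \<bullet> b \<le> l b + norm b * diameter U"
    by (rule choice[THEN exE])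
  then have l: "l b \<le> y \<bullet> b \<and> y \<bullet> b \<le> l b + norm b * diameter U" if "y \<in> U" for b y
    using that by blast
  define t where "t = s / 2 ^ n"
  have t: "0 < t" using s by (simp add: t_def)
  have d0: "0 \<le> diameter U / t" using diameter_ge_0[OF U] t by simp
  define lo where "lo b = (l b - a \<bullet> b) / t - 1" for b
  define X where "X b = {k::int. lo b \<le> k \<and> k \<le> lo b + 1 + diameter U / t}" for b
  have X: "finite (X b)" "real (card (X b)) \<le> diameter U / t + 2" for b
    using card_int_interval_le[of "lo b" "lo b + 1 + diameter U / t"] d0 by (auto simp: X_def)
  have sub: "W \<subseteq> PiE Basis X"
  proof
    fix w assume "w \<in> W"
    then obtain y where w: "w \<in> extensional Basis" and y: "y \<in> U" "y \<in> cell a s n w"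
      by (auto simp: W_def)
    have "w b \<in> X b" if b: "b \<in> Basis" for b
    proof -
      have 1: "t * w b \<le> (y - a) \<bullet> b" "(y - a) \<bullet> b \<le> t * (w b + 1)"
        using y b by (auto simp: cell_def t_def)
      have 2: "l b - a \<bullet> b \<le> (y - a) \<bullet> b" "(y - a) \<bullet> b \<le> l b - a \<bullet> b + diameter U"
        using l[OF y(1), of b] b by (auto simp: inner_diff_left)
      have "l b - a \<bullet> b \<le> (w b + 1) * t" "w b * t \<le> l b - a \<bullet> b + diameter U"
        using 1 2 by (auto simp: mult.commute)
      then have "(l b - a \<bullet> b) / t \<le> w b + 1" "w b \<le> (l b - a \<bullet> b + diameter U) / t"
        using t by (auto simp: pos_divide_le_eq pos_le_divide_eq)
      then show ?thesis by (auto simp: X_def lo_def add_divide_distrib)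
    qed
    then show "w \<in> PiE Basis X" using w by (auto simp: PiE_def)
  qed
  have fin: "finite (PiE Basis X)" using X by (intro finite_PiE) auto
  then show "finite W" using sub finite_subset by blast
  have "real (card W) \<le> real (card (PiE Basis X))"
    using card_mono[OF fin sub] by simp
  also have "\<dots> = (\<Prod>b\<in>(Basis::'a set). real (card (X b)))" by (simp add: card_PiE)
  also have "\<dots> \<le> (\<Prod>b\<in>(Basis::'a set). diameter U / t + 2)"
    using X by (intro prod_mono) auto
  also have "\<dots> = (diameter U / t + 2) ^ DIM('a)" by simp
  finally show "real (card W) \<le> (diameter U / (s / 2 ^ n) + 2) ^ DIM('a)" by (simp add: t_def)
qed

section \<open>The mass distribution principle\<close>

text \<open>
  The mass distribution principle for the image of Lebesgue measure on \<open>{0..<1}\<close>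
  under a map \<open>x\<close>. Measurability of \<open>x\<close> is not required: it is enough
  that the preimage of a set of diameter at most \<open>\<rho>\<close> is covered by a
  measurable set of measure at most \<open>c * \<rho> powr t\<close>. The radius
  \<open>\<rho>\<close> is kept positive, so that sets of diameter \<open>0\<close> need no
  special treatment from the user of the lemma.
\<close>

lemma mass_distribution:
  fixes x :: "real \<Rightarrow> 'a::metric_space" and A :: "'a set"
  assumes A: "x ` {0..<1} \<subseteq> A" and t: "0 < t" and c: "0 < c"
    and cover: "\<And>U \<rho>. bounded U \<Longrightarrow> U \<noteq> {} \<Longrightarrow> diameter U \<le> \<rho> \<Longrightarrow> 0 < \<rho> \<Longrightarrow>
      \<exists>V\<in>sets lborel. {y\<in>{0..<1}. x y \<in> U} \<subseteq> V \<and> emeasure lborel V \<le> ennreal (c * \<rho> powr t)"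
  shows "ereal t \<le> hausdorff_dim A"
proof -
  have exact: "\<exists>V\<in>sets lborel. {y\<in>{0..<1}. x y \<in> U} \<subseteq> V \<and>
      emeasure lborel V \<le> ennreal c * ennreal (if U = {} then 0 else diameter U powr t)" if U: "bounded U" for U
  proof (cases "U = {} \<or> 0 < diameter U")
    case True
    then show ?thesis
    proof
      assume "U = {}"
      then show ?thesis by (intro bexI[of _ "{}"]) auto
    next
      assume "0 < diameter U"
      then have "U \<noteq> {}" by auto
      then show ?thesis using cover[OF U _ order_refl \<open>0 < diameter U\<close>] c
        by (simp add: ennreal_mult)
    qed
  next
    case False
    then have U0: "U \<noteq> {}" "diameter U = 0" using diameter_ge_0[OF U] by auto
    have "\<exists>V\<in>sets lborel. {y\<in>{0..<1}. x y \<in> U} \<subseteq> V \<and> emeasure lborel V \<le> ennreal (c * (1 / Suc n) powr t)" for n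
      by (rule cover[OF U U0(1)]) (use U0 in simp_all)
    then have "\<forall>n. \<exists>V. V \<in> sets lborel \<and> {y\<in>{0..<1}. x y \<in> U} \<subseteq> V \<and>
        emeasure lborel V \<le> ennreal (c * (1 / Suc n) powr t)"
      unfolding Bex_def by (rule allI)
    then obtain V where "\<forall>n. V n \<in> sets lborel \<and> {y\<in>{0..<1}. x y \<in> U} \<subseteq> V n \<and>
        emeasure lborel (V n) \<le> ennreal (c * (1 / Suc n) powr t)"
      by (rule choice[THEN exE])
    then have V: "V n \<in> sets lborel" "{y\<in>{0..<1}. x y \<in> U} \<subseteq> V n"
        "emeasure lborel (V n) \<le> ennreal (c * (1 / Suc n) powr t)" for n
      by blast+
    have le: "emeasure lborel (\<Inter>n. V n) \<le> ennreal (c * (1 / Suc n) powr t)" for n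
      using V by (intro order_trans[OF emeasure_mono V(3)]) auto
    have "(\<lambda>n. c * (1 / Suc n) powr t) \<longlonglongrightarrow> c * 0 powr t"
      using t by (intro tendsto_intros LIMSEQ_Suc[OF lim_1_over_n]) auto
    then have "(\<lambda>n. ennreal (c * (1 / Suc n) powr t)) \<longlonglongrightarrow> ennreal 0"
      by (intro tendsto_ennrealI) simp
    then have "emeasure lborel (\<Inter>n. V n) \<le> ennreal 0"
      by (rule LIMSEQ_le_const) (use le in auto)
    then show ?thesis using V by (intro bexI[of _ "\<Inter>n. V n"]) auto
  qed
  have "t \<le> s" if s: "0 \<le> s" "hausdorff_measure s A = 0" for s
  proof (rule ccontr)
    assume "\<not> t \<le> s"
    then have st: "s < t" by simp
    \<comment> \<open>For sets of diameter at most 1 the sum with exponent \<open>s < t\<close> dominates the one with exponent \<open>t\<close>,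
      so the content at scale 1 is already bounded below.\<close>
    have "hausdorff_content s 1 A \<le> 0"
      unfolding s(2)[symmetric] hausdorff_measure_def by (rule SUP_upper) simp
    moreover have "ennreal (1 / c) \<le> hausdorff_content s 1 A"
      unfolding hausdorff_content_def
    proof (rule INF_greatest)
      fix U :: "nat \<Rightarrow> 'a set"
      assume "U \<in> {U. A \<subseteq> (\<Union>j. U j) \<and> (\<forall>j. bounded (U j) \<and> diameter (U j) \<le> 1)}"
      then have U: "A \<subseteq> (\<Union>j. U j)" "\<And>j. bounded (U j)" "\<And>j. diameter (U j) \<le> 1" by auto
      have "\<forall>j. \<exists>V. V \<in> sets lborel \<and> {y\<in>{0..<1}. x y \<in> U j} \<subseteq> V \<and>
          emeasure lborel V \<le> ennreal c * ennreal (if U j = {} then 0 else diameter (U j) powr t)"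
        using exact[OF U(2)] unfolding Bex_def by (rule allI)
      then obtain V where "\<forall>j. V j \<in> sets lborel \<and> {y\<in>{0..<1}. x y \<in> U j} \<subseteq> V j \<and>
          emeasure lborel (V j) \<le> ennreal c * ennreal (if U j = {} then 0 else diameter (U j) powr t)"
        by (rule choice[THEN exE])
      then have V: "V j \<in> sets lborel" "{y\<in>{0..<1}. x y \<in> U j} \<subseteq> V j"
          "emeasure lborel (V j) \<le> ennreal c * ennreal (if U j = {} then 0 else diameter (U j) powr t)" for j
        by blast+
      have "{0..<1} \<subseteq> (\<Union>j. V j)"
      proof
        fix y :: real assume y: "y \<in> {0..<1}"
        then obtain j where "x y \<in> U j" using A U(1) by blast
        then show "y \<in> (\<Union>j. V j)" using V(2)[of j] y by blast
      qed
      then have "1 \<le> emeasure lborel (\<Union>j. V j)"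
        using emeasure_mono[of "{0..<1}" "\<Union>j. V j" lborel] V(1) by auto
      also have "\<dots> \<le> (\<Sum>j. emeasure lborel (V j))"
        using V(1) by (intro emeasure_subadditive_countably) auto
      also have "\<dots> \<le> (\<Sum>j. ennreal c * ennreal (if U j = {} then 0 else if s = 0 then 1 else diameter (U j) powr s))"
      proof (intro suminf_le order_trans[OF V(3)] mult_left_mono ennreal_leI)
        fix j
        have "diameter (U j) powr t \<le> diameter (U j) powr s"
          by (rule powr_mono') (use st U(3)[of j] diameter_ge_0[OF U(2), of j] in simp_all)
        moreover have "diameter (U j) powr t \<le> 1"
          using t U(3)[of j] diameter_ge_0[OF U(2), of j] by (simp add: powr_le1)
        ultimately show "(if U j = {} then 0 else diameter (U j) powr t)
            \<le> (if U j = {} then 0 else if s = 0 then 1 else diameter (U j) powr s)"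
          by simp
      qed auto
      also have "\<dots> = ennreal c * (\<Sum>j. ennreal (if U j = {} then 0 else if s = 0 then 1 else diameter (U j) powr s))"
        by simp
      finally have *: "1 \<le> ennreal c * (\<Sum>j. ennreal (if U j = {} then 0 else if s = 0 then 1 else diameter (U j) powr s))" .
      have inv: "ennreal (1 / c) * ennreal c = 1" using c by (simp add: ennreal_mult[symmetric])
      have "ennreal (1 / c) = ennreal (1 / c) * 1" by simp
      also have "\<dots> \<le> ennreal (1 / c) * (ennreal c * (\<Sum>j. ennreal (if U j = {} then 0 else if s = 0 then 1 else diameter (U j) powr s)))"
        by (intro mult_left_mono *) simp
      also have "\<dots> = (\<Sum>j. ennreal (if U j = {} then 0 else if s = 0 then 1 else diameter (U j) powr s))"
        by (simp only: mult.assoc[symmetric] inv mult_1)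
      finally show "ennreal (1 / c) \<le> (\<Sum>j. ennreal (if U j = {} then 0 else if s = 0 then 1 else diameter (U j) powr s))" .
    qed
    ultimately show False using c by (simp add: ennreal_eq_0_iff)
  qed
  then show ?thesis unfolding hausdorff_dim_def by (intro INF_greatest) auto
qed

section \<open>Removing a sparse family of sets\<close>

text \<open>
  A family of diameters with sum of \<open>c\<close>-th powers at most \<open>T powr c\<close>
  counts no more than a single set of diameter \<open>T\<close>, both for the exponent
  \<open>c\<close> and for the larger exponent \<open>d\<close>: each single diameter is at most
  \<open>T\<close>.
\<close>

lemma sum_powr_group_le:
  fixes g :: "'p \<Rightarrow> real"
  assumes "finite F" and pos: "\<And>p. p \<in> F \<Longrightarrow> 0 < g p" and T: "0 \<le> T"
    and c: "0 < c" "c < real d" and "0 < s" "0 < \<gamma>"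
    and sum: "(\<Sum>p\<in>F. g p powr c) \<le> T powr c"
  shows "(\<Sum>p\<in>F. (g p / s) ^ d + (g p / (\<gamma> * s)) powr c) \<le> (T / s) ^ d + (T / (\<gamma> * s)) powr c"
proof -
  have le: "g p \<le> T" if p: "p \<in> F" for p
  proof (rule ccontr)
    assume "\<not> g p \<le> T"
    then have "T powr c < g p powr c" using T c by (intro powr_less_mono2) auto
    also have "\<dots> \<le> (\<Sum>p\<in>F. g p powr c)" by (rule member_le_sum[OF p]) (use assms in auto)
    finally show False using sum by simp
  qed
  have pw: "(y / s) ^ d = y powr c * y powr (real d - c) / s ^ d" if "0 < y" for y
    using that c by (simp add: powr_add[symmetric] powr_realpow power_divide)
  have "(\<Sum>p\<in>F. (g p / s) ^ d) \<le> (\<Sum>p\<in>F. g p powr c * (T powr (real d - c) / s ^ d))"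
  proof (rule sum_mono)
    fix p assume p: "p \<in> F"
    have "g p powr c * g p powr (real d - c) / s ^ d \<le> g p powr c * T powr (real d - c) / s ^ d"
      using le[OF p] pos[OF p] c assms(6) by (intro divide_right_mono mult_left_mono powr_mono2) auto
    then show "(g p / s) ^ d \<le> g p powr c * (T powr (real d - c) / s ^ d)"
      using pw[OF pos[OF p]] by simp
  qed
  also have "\<dots> = (\<Sum>p\<in>F. g p powr c) * (T powr (real d - c) / s ^ d)"
    by (rule sum_distrib_right[symmetric])
  also have "\<dots> \<le> T powr c * (T powr (real d - c) / s ^ d)"
    using sum assms by (intro mult_right_mono) auto
  also have "\<dots> \<le> (T / s) ^ d"
  proof (cases "T = 0")
    case False
    then show ?thesis using pw[of T] T by simp
  qed (use assms in auto)
  finally have 1: "(\<Sum>p\<in>F. (g p / s) ^ d) \<le> (T / s) ^ d" .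
  have "(\<Sum>p\<in>F. (g p / (\<gamma> * s)) powr c) = (\<Sum>p\<in>F. g p powr c) / (\<gamma> * s) powr c"
    using assms pos by (simp add: sum_divide_distrib powr_divide order_less_imp_le)
  also have "\<dots> \<le> T powr c / (\<gamma> * s) powr c"
    using sum assms by (intro divide_right_mono) auto
  also have "\<dots> = (T / (\<gamma> * s)) powr c" using assms by (simp add: powr_divide)
  finally show ?thesis using 1 by (simp add: sum.distrib)
qed

text \<open>
  In units of the cell side, \<open>h\<close> is the diameter of a set and \<open>(h + 2) ^
  d\<close> bounds the number of cells that it meets. The weight \<open>min 1 _\<close> makes
  the product of order \<open>h ^ d\<close> for large sets, and of the order of the contribution
  \<open>(h / \<gamma>) powr c\<close> to the potential for small ones.
\<close>

lemma weight_le: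
  fixes h \<gamma> c :: real
  assumes "0 < h" "0 < \<gamma>"
  shows "min 1 ((h / \<gamma>) powr c) * (h + 2) ^ d \<le> 3 ^ d * (h ^ d + (h / \<gamma>) powr c)"
proof (cases "1 \<le> h")
  case True
  have "min 1 ((h / \<gamma>) powr c) * (h + 2) ^ d \<le> 1 * (3 * h) ^ d"
    using True by (intro mult_mono power_mono) auto
  also have "\<dots> \<le> 3 ^ d * (h ^ d + (h / \<gamma>) powr c)" by (simp add: power_mult_distrib)
  finally show ?thesis .
next
  case False
  have "min 1 ((h / \<gamma>) powr c) * (h + 2) ^ d \<le> (h / \<gamma>) powr c * 3 ^ d"
    using False assms by (intro mult_mono power_mono) auto
  also have "\<dots> \<le> 3 ^ d * (h ^ d + (h / \<gamma>) powr c)" using assms by (simp add: distrib_left)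
  finally show ?thesis .
qed

lemma two_power_powr:
  fixes c :: real
  shows "(2 ^ i) powr c = 2 ^ (i * d) * (2 powr (c - real d)) ^ i"
proof -
  have "(2 ^ i) powr c = 2 powr (real i * c)"
    using powr_powr[of 2 "real i" c] powr_realpow[of 2 i] by simp
  also have "real i * c = real (i * d) + (c - real d) * real i" by (simp add: algebra_simps)
  also have "2 powr \<dots> = 2 powr real (i * d) * 2 powr ((c - real d) * real i)" by (rule powr_add)
  also have "2 powr real (i * d) = (2 :: real) ^ (i * d)" by (rule powr_realpow) simp
  also have "2 powr ((c - real d) * real i) = (2 powr (c - real d)) ^ i"
    by (simp add: powr_power mult.commute)
  finally show ?thesis .
qed

text \<open>
  Given sets \<open>U p\<close>, for \<open>p \<in> J\<close>, that are to be removed, and a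
  level for each of them from which on it is taken into account: a cell is low if the sets taken
  into account so far and meeting it have a small sum of \<open>c\<close>-th powers of
  diameters, compared with the side of the cell. There may be infinitely many such sets; the
  bound is imposed on all finite subfamilies.
\<close>

definition low ::
  "'a::euclidean_space \<Rightarrow> real \<Rightarrow> 'p set \<Rightarrow> ('p \<Rightarrow> 'a set) \<Rightarrow> ('p \<Rightarrow> nat) \<Rightarrow> real \<Rightarrow> real \<Rightarrow> nat \<Rightarrow> ('a \<Rightarrow> int) \<Rightarrow> bool"
where
  "low a s J U lev c \<gamma> n v \<longleftrightarrow>
     (\<forall>F. finite F \<longrightarrow> F \<subseteq> {p\<in>J. lev p \<le> n \<and> U p \<inter> cell a s n v \<noteq> {}} \<longrightarrow>
       (\<Sum>p\<in>F. diameter (U p) powr c) \<le> (\<gamma> * (s / 2 ^ n)) powr c)"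

text \<open>
  The main counting argument. Assumption \<open>new\<close> says that the sets of level
  \<open>n\<close> meeting a given cell of level \<open>n\<close> are together no larger than
  one set of diameter \<open>\<alpha>\<close> times the side of the cell, in the sense of sums
  of \<open>c\<close>-th powers of diameters. Under \<open>small\<close>, at most half of the
  subcells \<open>N\<close> levels below a low cell fail to be low.

  A subcell that is not low meets a finite family of sets with total weight at least 1, where
  the weight of a set of diameter \<open>g\<close> is \<open>min 1 ((g / (\<gamma> * s')) powr
  c)\<close> and \<open>s'\<close> is the side of the subcells. Exchanging sums, the number of
  such subcells is at most the sum of weight times number of cells met, which is estimated
  separately for the sets already present in the low cell and, for \<open>j = 1, ..., N\<close>,
  for the new sets in each of the cells \<open>j\<close> levels below it. The contributions of
  the potential decay geometrically, because \<open>c < DIM('a)\<close>; the volume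
  contributions give the summand \<open>N * \<alpha> ^ DIM('a)\<close>.
\<close>

lemma card_not_low:
  fixes a :: "'a::euclidean_space" and s :: real and J :: "'p set" and U :: "'p \<Rightarrow> 'a set"
    and lev :: "'p \<Rightarrow> nat" and c \<alpha> \<gamma> :: real and N :: nat
  assumes s: "0 < s" and c: "0 < c" "c < DIM('a)" and \<alpha>: "0 \<le> \<alpha>" and \<gamma>: "0 < \<gamma>"
    and U: "\<And>p. p \<in> J \<Longrightarrow> bounded (U p)" "\<And>p. p \<in> J \<Longrightarrow> 0 < diameter (U p)"
    and new: "\<And>n v F. finite F \<Longrightarrow> 1 \<le> n \<Longrightarrow> F \<subseteq> {p\<in>J. lev p = n \<and> U p \<inter> cell a s n v \<noteq> {}} \<Longrightarrow>
      (\<Sum>p\<in>F. diameter (U p) powr c) \<le> (\<alpha> * (s / 2 ^ n)) powr c"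
    and small: "3 ^ DIM('a) * (\<gamma> ^ DIM('a) + (2 powr (c - DIM('a))) ^ N + N * \<alpha> ^ DIM('a)
        + (\<alpha> / \<gamma>) powr c / (1 - 2 powr (c - DIM('a)))) \<le> 1 / 2"
    and low: "low a s J U lev c \<gamma> m v"
  shows "real (card {w\<in>subcells N v. \<not> low a s J U lev c \<gamma> (m + N) w}) \<le> 2 ^ (N * DIM('a)) / 2"
proof -
  let ?d = "DIM('a)"
  define W where "W = {w\<in>subcells N v. \<not> low a s J U lev c \<gamma> (m + N) w}"
  define s' where "s' = s / 2 ^ (m + N)"
  have s': "0 < s'" using s by (simp add: s'_def)
  define g where "g p = diameter (U p)" for p
  define met where "met p w \<longleftrightarrow> U p \<inter> cell a s (m + N) w \<noteq> {}" for p w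
  define q where "q = 2 powr (c - ?d)"
  have q: "0 < q" "q < 1" using c by (auto simp: q_def powr_less_one)
  have finW: "finite W" unfolding W_def by (rule finite_subset[OF _ finite_subcells[of N v]]) auto
  have "\<exists>F. finite F \<and> F \<subseteq> {p\<in>J. lev p \<le> m + N \<and> met p w} \<and> (\<gamma> * s') powr c < (\<Sum>p\<in>F. g p powr c)"
    if "w \<in> W" for w
  proof -
    have "\<not> low a s J U lev c \<gamma> (m + N) w" using that by (simp add: W_def)
    then show ?thesis
      unfolding low_def met_def s'_def g_def by (simp only: not_all not_imp not_le simp_thms)
  qed
  then have "\<forall>w\<in>W. \<exists>F. finite F \<and> F \<subseteq> {p\<in>J. lev p \<le> m + N \<and> met p w} \<and>
      (\<gamma> * s') powr c < (\<Sum>p\<in>F. g p powr c)"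
    by (rule ballI)
  then obtain Fw where "\<forall>w\<in>W. finite (Fw w) \<and> Fw w \<subseteq> {p\<in>J. lev p \<le> m + N \<and> met p w} \<and>
      (\<gamma> * s') powr c < (\<Sum>p\<in>Fw w. g p powr c)"
    by (rule bchoice[THEN exE])
  then have Fw: "finite (Fw w)" "Fw w \<subseteq> {p\<in>J. lev p \<le> m + N \<and> met p w}"
      "(\<gamma> * s') powr c < (\<Sum>p\<in>Fw w. g p powr c)" if "w \<in> W" for w
    using that by blast+
  define FF where "FF = (\<Union>w\<in>W. Fw w)"
  have finF: "finite FF" using finW Fw(1) by (auto simp: FF_def)
  have FJ: "p \<in> J" "0 < g p" "lev p \<le> m + N" if "p \<in> FF" for p
    using that Fw(2) U(2) by (auto simp: FF_def g_def)
  define k where "k p = min 1 ((g p / (\<gamma> * s')) powr c)" for p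
  define f where "f p = (g p / s') ^ ?d + (g p / (\<gamma> * s')) powr c" for p
  have k0: "0 \<le> k p" for p by (simp add: k_def)
  have one: "1 \<le> (\<Sum>p | p \<in> FF \<and> met p w. k p)" if w: "w \<in> W" for w
  proof -
    have sub: "Fw w \<subseteq> {p. p \<in> FF \<and> met p w}" using Fw(2)[OF w] w by (auto simp: FF_def)
    have "1 \<le> (\<Sum>p\<in>Fw w. k p)"
    proof (cases "\<exists>p\<in>Fw w. 1 \<le> (g p / (\<gamma> * s')) powr c")
      case True
      then obtain p where p: "p \<in> Fw w" "k p = 1" by (auto simp: k_def min_def)
      then show ?thesis using member_le_sum[OF p(1), of k] k0 Fw(1)[OF w] by simp
    next
      case False
      have "(\<Sum>p\<in>Fw w. k p) = (\<Sum>p\<in>Fw w. (g p / (\<gamma> * s')) powr c)"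
        using False by (intro sum.cong) (auto simp: k_def min_def not_le order_less_imp_le)
      also have "\<dots> = (\<Sum>p\<in>Fw w. g p powr c / (\<gamma> * s') powr c)"
      proof (rule sum.cong[OF refl])
        fix p assume "p \<in> Fw w"
        then have "0 < g p" using FJ(2) w by (auto simp: FF_def)
        then show "(g p / (\<gamma> * s')) powr c = g p powr c / (\<gamma> * s') powr c"
          using s' \<gamma> by (simp add: powr_divide)
      qed
      also have "\<dots> = (\<Sum>p\<in>Fw w. g p powr c) / (\<gamma> * s') powr c"
        by (simp add: sum_divide_distrib)
      finally show ?thesis using Fw(3)[OF w] \<gamma> s' by (simp add: pos_le_divide_eq)
    qed
    also have "\<dots> \<le> (\<Sum>p | p \<in> FF \<and> met p w. k p)"
      using sub finF k0 by (intro sum_mono2) auto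
    finally show ?thesis .
  qed
  have "real (card W) = (\<Sum>w\<in>W. 1)" by simp
  also have "\<dots> \<le> (\<Sum>w\<in>W. \<Sum>p | p \<in> FF \<and> met p w. k p)" by (rule sum_mono) (use one in auto)
  also have "\<dots> = (\<Sum>p\<in>FF. \<Sum>w | w \<in> W \<and> met p w. k p)"
    by (rule sum.swap_restrict[OF finW finF])
  also have "\<dots> \<le> (\<Sum>p\<in>FF. 3 ^ ?d * f p)"
  proof (rule sum_mono)
    fix p assume p: "p \<in> FF"
    have "{w. w \<in> W \<and> met p w} \<subseteq> {w \<in> extensional Basis. U p \<inter> cell a s (m + N) w \<noteq> {}}"
      by (auto simp: W_def met_def dest: subcells_extensional)
    then have "real (card {w. w \<in> W \<and> met p w}) \<le> (g p / s' + 2) ^ ?d"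
      using card_cells_meeting[OF s U(1)[OF FJ(1)[OF p]] refl, of a "m + N"]
      unfolding g_def s'_def by (meson card_mono of_nat_mono order_trans)
    then have "(\<Sum>w | w \<in> W \<and> met p w. k p) \<le> k p * (g p / s' + 2) ^ ?d"
      using k0[of p] by (simp add: mult.commute mult_left_mono)
    also have "\<dots> \<le> 3 ^ ?d * ((g p / s') ^ ?d + ((g p / s') / \<gamma>) powr c)"
      using weight_le[of "g p / s'" \<gamma> c ?d] FJ(2)[OF p] s' \<gamma> by (simp add: k_def mult.commute)
    finally show "(\<Sum>w | w \<in> W \<and> met p w. k p) \<le> 3 ^ ?d * f p"
      by (simp add: f_def mult.commute)
  qed
  also have "\<dots> = 3 ^ ?d * (\<Sum>p\<in>FF. f p)" by (simp add: sum_distrib_left)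
  finally have cardW: "real (card W) \<le> 3 ^ ?d * (\<Sum>p\<in>FF. f p)" .

  define \<Psi> where "\<Psi> T = (T / s') ^ ?d + (T / (\<gamma> * s')) powr c" for T
  have f0: "0 \<le> f p" if "p \<in> FF" for p using FJ[OF that] s' by (simp add: f_def)
  \<comment> \<open>The sets present in the low cell, and the new ones in the cell \<open>u\<close> that is \<open>j\<close> levels below it.\<close>
  define F0 where "F0 = {p\<in>FF. lev p \<le> m}"
  define Fj where "Fj j u = {p\<in>FF. lev p = m + j \<and> U p \<inter> cell a s (m + j) u \<noteq> {}}" for j u
  have meets: "\<exists>u\<in>subcells j v. U p \<inter> cell a s (m + j) u \<noteq> {}" if p: "p \<in> FF" and j: "j \<le> N" for p j
  proof -
    obtain w where w: "w \<in> W" "p \<in> Fw w" using p by (auto simp: FF_def)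
    then have "met p w" using Fw(2) by blast
    have "w \<in> subcells (j + (N - j)) v" using w j by (simp add: W_def)
    then obtain u where u: "u \<in> subcells j v" "w \<in> subcells (N - j) u"
      by (auto simp only: subcells_add)
    have "cell a s (m + N) w \<subseteq> cell a s (m + j) u"
      using cell_subcells_subset[OF s u(2), of a "m + j"] j by simp
    then show ?thesis using u \<open>met p w\<close> by (auto simp: met_def)
  qed
  have g0: "(\<Sum>p\<in>F0. f p) \<le> \<Psi> (\<gamma> * (s / 2 ^ m))"
  proof -
    have "p \<in> {p\<in>J. lev p \<le> m \<and> U p \<inter> cell a s m v \<noteq> {}}" if "p \<in> F0" for p
    proof -
      have p: "p \<in> FF" "lev p \<le> m" using that by (auto simp: F0_def)
      obtain u where u: "u \<in> subcells 0 v" "U p \<inter> cell a s (m + 0) u \<noteq> {}"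
        using meets[OF p(1), of 0] by auto
      have "cell a s (m + 0) u \<subseteq> cell a s m v" by (rule cell_subcells_subset[OF s u(1)])
      then show ?thesis using u p FJ by auto
    qed
    then have "(\<Sum>p\<in>F0. g p powr c) \<le> (\<gamma> * (s / 2 ^ m)) powr c"
      using low finF unfolding low_def g_def
      by (metis (no_types, lifting) F0_def finite_subset mem_Collect_eq subsetI)
    then show ?thesis unfolding f_def \<Psi>_def
      by (intro sum_powr_group_le) (use finF FJ s s' \<gamma> c in \<open>auto simp: F0_def\<close>)
  qed
  have gj: "(\<Sum>p\<in>Fj j u. f p) \<le> \<Psi> (\<alpha> * (s / 2 ^ (m + j)))" if "j \<in> {1..N}" for j u
  proof -
    have "(\<Sum>p\<in>Fj j u. g p powr c) \<le> (\<alpha> * (s / 2 ^ (m + j))) powr c"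
      unfolding g_def by (rule new[of _ _ u]) (use finF FJ that in \<open>auto simp: Fj_def\<close>)
    then show ?thesis unfolding f_def \<Psi>_def
      by (intro sum_powr_group_le) (use finF FJ s s' \<gamma> c \<alpha> in \<open>auto simp: Fj_def\<close>)
  qed
  have "(\<Sum>p\<in>FF. f p) \<le> (\<Sum>p\<in>F0. f p) + (\<Sum>p\<in>FF. \<Sum>j\<in>{1..N}. \<Sum>u\<in>subcells j v. if p \<in> Fj j u then f p else 0)"
  proof -
    have "(\<Sum>p\<in>FF - F0. f p) \<le> (\<Sum>p\<in>FF - F0. \<Sum>j\<in>{1..N}. \<Sum>u\<in>subcells j v. if p \<in> Fj j u then f p else 0)"
    proof (rule sum_mono)
      fix p assume p: "p \<in> FF - F0"
      define j where "j = lev p - m"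
      have j: "j \<in> {1..N}" "lev p = m + j" using p FJ(3)[of p] by (auto simp: F0_def j_def)
      obtain u where u: "u \<in> subcells j v" "U p \<inter> cell a s (m + j) u \<noteq> {}"
        using meets[of p j] p j by auto
      have "f p = (if p \<in> Fj j u then f p else 0)" using p j u by (simp add: Fj_def)
      also have "\<dots> \<le> (\<Sum>u\<in>subcells j v. if p \<in> Fj j u then f p else 0)"
        using u f0 p by (intro member_le_sum) (auto simp: finite_subcells)
      also have "\<dots> \<le> (\<Sum>j\<in>{1..N}. \<Sum>u\<in>subcells j v. if p \<in> Fj j u then f p else 0)"
        using j f0 p
        by (intro member_le_sum[where f = "\<lambda>j. \<Sum>u\<in>subcells j v. if p \<in> Fj j u then f p else 0"])
           (auto intro!: sum_nonneg)
      finally show "f p \<le> (\<Sum>j\<in>{1..N}. \<Sum>u\<in>subcells j v. if p \<in> Fj j u then f p else 0)" .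
    qed
    also have "\<dots> \<le> (\<Sum>p\<in>FF. \<Sum>j\<in>{1..N}. \<Sum>u\<in>subcells j v. if p \<in> Fj j u then f p else 0)"
      using finF f0 by (intro sum_mono2) (auto intro!: sum_nonneg)
    finally show ?thesis
      using sum.subset_diff[of F0 FF f] finF by (auto simp: F0_def)
  qed
  also have "(\<Sum>p\<in>FF. \<Sum>j\<in>{1..N}. \<Sum>u\<in>subcells j v. if p \<in> Fj j u then f p else 0)
      = (\<Sum>j\<in>{1..N}. \<Sum>p\<in>FF. \<Sum>u\<in>subcells j v. if p \<in> Fj j u then f p else 0)"
    by (rule sum.swap)
  also have "\<dots> = (\<Sum>j\<in>{1..N}. \<Sum>u\<in>subcells j v. \<Sum>p\<in>FF. if p \<in> Fj j u then f p else 0)"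
    by (rule sum.cong[OF refl]) (rule sum.swap)
  also have "\<dots> = (\<Sum>j\<in>{1..N}. \<Sum>u\<in>subcells j v. \<Sum>p\<in>Fj j u. f p)"
  proof (rule sum.cong[OF refl], rule sum.cong[OF refl])
    fix j u
    have "Fj j u \<subseteq> FF" by (auto simp: Fj_def)
    then show "(\<Sum>p\<in>FF. if p \<in> Fj j u then f p else 0) = (\<Sum>p\<in>Fj j u. f p)"
      using finF by (simp add: sum.If_cases Int_absorb1)
  qed
  also have "\<dots> \<le> (\<Sum>j\<in>{1..N}. \<Sum>u\<in>subcells j v. \<Psi> (\<alpha> * (s / 2 ^ (m + j))))"
    by (intro sum_mono gj)
  also have "\<dots> = (\<Sum>j\<in>{1..N}. 2 ^ (j * ?d) * \<Psi> (\<alpha> * (s / 2 ^ (m + j))))"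
    by (simp add: card_subcells)
  finally have "(\<Sum>p\<in>FF. f p) \<le> (\<Sum>p\<in>F0. f p) + (\<Sum>j\<in>{1..N}. 2 ^ (j * ?d) * \<Psi> (\<alpha> * (s / 2 ^ (m + j))))"
    by simp
  moreover have "\<Psi> (\<gamma> * (s / 2 ^ m)) = 2 ^ (N * ?d) * (\<gamma> ^ ?d + q ^ N)"
  proof -
    have 1: "s / 2 ^ m / s' = 2 ^ N" using s by (simp add: s'_def power_add)
    have "(2 ^ N :: real) powr c = 2 ^ (N * ?d) * q ^ N"
      unfolding q_def by (rule two_power_powr)
    moreover have "\<gamma> * (s / 2 ^ m) / (\<gamma> * s') = 2 ^ N" using 1 \<gamma> by simp
    moreover have "\<gamma> * (s / 2 ^ m) / s' = \<gamma> * 2 ^ N" using 1 by (metis times_divide_eq_right)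
    ultimately show ?thesis
      by (simp add: \<Psi>_def power_mult_distrib power_mult algebra_simps)
  qed
  moreover have "(\<Sum>j\<in>{1..N}. 2 ^ (j * ?d) * \<Psi> (\<alpha> * (s / 2 ^ (m + j))))
      \<le> 2 ^ (N * ?d) * (N * \<alpha> ^ ?d + (\<alpha> / \<gamma>) powr c / (1 - q))"
  proof -
    have jth: "2 ^ (j * ?d) * \<Psi> (\<alpha> * (s / 2 ^ (m + j))) = 2 ^ (N * ?d) * (\<alpha> ^ ?d + (\<alpha> / \<gamma>) powr c * q ^ (N - j))"
      if "j \<in> {1..N}" for j
    proof -
      obtain i where i: "N = j + i" using \<open>j \<in> {1..N}\<close> by (auto simp: le_iff_add)
      have 1: "s / 2 ^ (m + j) / s' = 2 ^ i" using s by (simp add: s'_def power_add i)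
      have "(2 ^ i :: real) powr c = 2 ^ (i * ?d) * q ^ i"
        unfolding q_def by (rule two_power_powr)
      moreover have "\<alpha> * (s / 2 ^ (m + j)) / (\<gamma> * s') = \<alpha> / \<gamma> * 2 ^ i" using 1 \<gamma>
        by (metis times_divide_times_eq)
      moreover have "\<alpha> * (s / 2 ^ (m + j)) / s' = \<alpha> * 2 ^ i" using 1 by (metis times_divide_eq_right)
      moreover have "(\<alpha> / \<gamma> * 2 ^ i) powr c = (\<alpha> / \<gamma>) powr c * (2 ^ i) powr c"
        by (rule powr_mult)
      ultimately have "\<Psi> (\<alpha> * (s / 2 ^ (m + j))) = (\<alpha> * 2 ^ i) ^ ?d + (\<alpha> / \<gamma>) powr c * (2 ^ (i * ?d) * q ^ i)"
        unfolding \<Psi>_def by simp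
      also have "\<dots> = 2 ^ (i * ?d) * (\<alpha> ^ ?d + (\<alpha> / \<gamma>) powr c * q ^ i)"
        by (simp add: power_mult_distrib power_mult algebra_simps)
      finally show ?thesis by (simp add: i power_add algebra_simps)
    qed
    have geo: "(\<Sum>j\<in>{1..N}. q ^ (N - j)) \<le> 1 / (1 - q)"
    proof -
      have "(\<Sum>j\<in>{1..N}. q ^ (N - j)) = (\<Sum>i<N. q ^ i)"
        by (rule sum.reindex_bij_witness[of _ "\<lambda>i. N - i" "\<lambda>j. N - j"]) auto
      also have "\<dots> = (1 - q ^ N) / (1 - q)" using q by (simp add: sum_gp_strict)
      also have "\<dots> \<le> 1 / (1 - q)" using q by (intro divide_right_mono) auto
      finally show ?thesis .
    qed
    have "(\<Sum>j\<in>{1..N}. 2 ^ (j * ?d) * \<Psi> (\<alpha> * (s / 2 ^ (m + j))))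
        = (\<Sum>j\<in>{1..N}. 2 ^ (N * ?d) * (\<alpha> ^ ?d + (\<alpha> / \<gamma>) powr c * q ^ (N - j)))"
      by (rule sum.cong[OF refl jth])
    also have "\<dots> = 2 ^ (N * ?d) * (N * \<alpha> ^ ?d + (\<alpha> / \<gamma>) powr c * (\<Sum>j\<in>{1..N}. q ^ (N - j)))"
      by (simp add: sum_distrib_left sum.distrib distrib_left)
    also have "\<dots> \<le> 2 ^ (N * ?d) * (N * \<alpha> ^ ?d + (\<alpha> / \<gamma>) powr c * (1 / (1 - q)))"
      using geo by (intro mult_left_mono add_left_mono) auto
    finally show ?thesis by simp
  qed
  ultimately have "(\<Sum>p\<in>FF. f p) \<le> 2 ^ (N * ?d) * (\<gamma> ^ ?d + q ^ N + N * \<alpha> ^ ?d + (\<alpha> / \<gamma>) powr c / (1 - q))"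
    using g0 by (simp add: distrib_left)
  then have "3 ^ ?d * (\<Sum>p\<in>FF. f p) \<le> 2 ^ (N * ?d) * (3 ^ ?d * (\<gamma> ^ ?d + q ^ N + N * \<alpha> ^ ?d + (\<alpha> / \<gamma>) powr c / (1 - q)))"
    using mult_left_mono[of _ _ "3 ^ ?d :: real"] by (simp add: mult.left_commute)
  also have "\<dots> \<le> 2 ^ (N * ?d) * (1 / 2)"
    using small unfolding q_def by (intro mult_left_mono) auto
  finally show ?thesis using cardW by (simp add: W_def)
qed

lemma subcells_enumeration:
  fixes v :: "'a::euclidean_space \<Rightarrow> int"
  assumes bad: "real (card {w\<in>subcells N v. \<not> P w}) \<le> 2 ^ (N * DIM('a)) / 2" and N: "1 \<le> N"
  shows "\<exists>e. inj_on e {..<2 ^ (N * DIM('a) - 1) :: nat} \<and>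
    e ` {..<2 ^ (N * DIM('a) - 1) :: nat} \<subseteq> {w\<in>subcells N v. P w}"
proof -
  let ?D = "N * DIM('a)"
  let ?L = "{w\<in>subcells N v. P w}" and ?B = "{w\<in>subcells N v. \<not> P w}"
  have fin: "finite ?L" "finite ?B" by (rule finite_subset[OF _ finite_subcells[of N v]], auto)+
  have "subcells N v = ?L \<union> ?B" "?L \<inter> ?B = {}" by blast+
  then have "card (subcells N v) = card ?L + card ?B"
    using card_Un_disjoint[OF fin] by simp
  then have sum: "2 ^ ?D = card ?L + card ?B" by (simp add: card_subcells)
  have "?D \<noteq> 0" using N by simp
  then obtain e where e: "?D = Suc e" using not0_implies_Suc by blast
  have "real (card ?B) \<le> 2 ^ e" using bad by (simp add: e)
  then have "card ?B \<le> 2 ^ e" using of_nat_le_iff[of "card ?B" "2 ^ e", where ?'a = real] by simp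
  then have "2 ^ (?D - 1) \<le> card ?L" using sum unfolding e by simp
  then have le: "card {..<2 ^ (?D - 1) :: nat} \<le> card ?L" by (simp only: card_lessThan)
  obtain f where f: "f ` {..<2 ^ (?D - 1) :: nat} \<subseteq> ?L \<and> inj_on f {..<2 ^ (?D - 1) :: nat}"
    by (rule exE[OF card_le_inj[OF finite_lessThan fin(1) le]])
  show ?thesis by (rule exI[of _ f]) (rule conjI[OF conjunct2[OF f] conjunct1[OF f]])
qed

text \<open>
  In addition to the assumptions for the counting argument, \<open>start\<close> says that the
  cell of level 0 at the origin of the grid is low. Keeping \<open>R = 2 ^ (N * DIM('a) -
  1)\<close> low subcells in each step gives a tree with \<open>R ^ k\<close> cells of level
  \<open>k * N\<close>. The cells along the branch given by the base-\<open>R\<close> digits of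
  a number \<open>y\<close> in \<open>{0..<1}\<close> shrink to a point \<open>x y\<close>. Such
  a point lies in no \<open>U p\<close>, since all low cells containing it would meet \<open>U
  p\<close>, which forces the diameter of \<open>U p\<close> to be 0. A set of diameter at most
  \<open>s / 2 ^ (k * N)\<close> meets at most \<open>3 ^ DIM('a)\<close> cells of that level,
  hence corresponds to at most that many intervals of length \<open>1 / R ^ k\<close>, where
  \<open>R = (2 ^ N) powr (DIM('a) - 1 / N)\<close>.
\<close>

proposition hausdorff_dim_ge:
  fixes a :: "'a::euclidean_space" and s :: real and J :: "'p set" and U :: "'p \<Rightarrow> 'a set"
    and lev :: "'p \<Rightarrow> nat" and c \<alpha> \<gamma> :: real and N :: nat
    and A :: "'a set"
  assumes s: "0 < s" and c: "0 < c" "c < DIM('a)" and \<alpha>: "0 \<le> \<alpha>" and \<gamma>: "0 < \<gamma>"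
    and U: "\<And>p. p \<in> J \<Longrightarrow> bounded (U p)" "\<And>p. p \<in> J \<Longrightarrow> 0 < diameter (U p)"
    and new: "\<And>n v F. finite F \<Longrightarrow> 1 \<le> n \<Longrightarrow> F \<subseteq> {p\<in>J. lev p = n \<and> U p \<inter> cell a s n v \<noteq> {}} \<Longrightarrow>
      (\<Sum>p\<in>F. diameter (U p) powr c) \<le> (\<alpha> * (s / 2 ^ n)) powr c"
    and start: "\<And>F. finite F \<Longrightarrow> F \<subseteq> {p\<in>J. lev p = 0 \<and> U p \<inter> cell a s 0 (\<lambda>b\<in>Basis. 0) \<noteq> {}} \<Longrightarrow>
      (\<Sum>p\<in>F. diameter (U p) powr c) \<le> (\<gamma> * s) powr c"
    and small: "3 ^ DIM('a) * (\<gamma> ^ DIM('a) + (2 powr (c - DIM('a))) ^ N + N * \<alpha> ^ DIM('a)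
        + (\<alpha> / \<gamma>) powr c / (1 - 2 powr (c - DIM('a)))) \<le> 1 / 2"
    and N: "2 \<le> N * DIM('a)" and A: "cell a s 0 (\<lambda>b\<in>Basis. 0) - (\<Union>p\<in>J. U p) \<subseteq> A"
  shows "ereal (real DIM('a) - 1 / N) \<le> hausdorff_dim A"
proof -
  let ?d = "DIM('a)"
  define R :: nat where "R = 2 ^ (N * ?d - 1)"
  have N1: "1 \<le> N" using N by (cases N) auto
  have R: "0 < R" by (simp add: R_def)
  have half: "real (card {w\<in>subcells N v. \<not> low a s J U lev c \<gamma> (m + N) w}) \<le> 2 ^ (N * ?d) / 2"
    if low: "low a s J U lev c \<gamma> m v" for m v
    by (rule card_not_low[OF s c \<alpha> \<gamma> _ _ _ small low], fact U(1), fact U(2), fact new)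
  define E where "E m v = (SOME e. inj_on e {..<R} \<and> e ` {..<R} \<subseteq> {w\<in>subcells N v. low a s J U lev c \<gamma> (m + N) w})" for m v
  have E: "inj_on (E m v) {..<R}" "E m v ` {..<R} \<subseteq> {w\<in>subcells N v. low a s J U lev c \<gamma> (m + N) w}" if "low a s J U lev c \<gamma> m v" for m v
    using someI_ex[OF subcells_enumeration[OF half[OF that] N1]] unfolding E_def R_def by blast+
  \<comment> \<open>\<open>T k i\<close> is the \<open>i\<close>-th kept cell of level \<open>k * N\<close>, for \<open>i < R ^ k\<close>; its children have
    the indices \<open>R * i, ..., R * i + R - 1\<close>.\<close>
  define T :: "nat \<Rightarrow> nat \<Rightarrow> 'a \<Rightarrow> int" where
    "T = rec_nat (\<lambda>_. \<lambda>b\<in>Basis. 0) (\<lambda>k Tk i. E (k * N) (Tk (i div R)) (i mod R))"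
  have T0: "T 0 i = (\<lambda>b\<in>Basis. 0)" for i by (simp add: T_def)
  have TS: "T (Suc k) i = E (k * N) (T k (i div R)) (i mod R)" for k i by (simp add: T_def)
  have lowT: "low a s J U lev c \<gamma> (k * N) (T k i)" for k i
  proof (induction k arbitrary: i)
    case 0
    have "low a s J U lev c \<gamma> 0 (\<lambda>b\<in>Basis. 0)" unfolding low_def using start by auto
    then show ?case by (simp only: T0 mult_0)
  next
    case (Suc k)
    then show ?case using E(2)[OF Suc, of "i div R"] R by (auto simp: TS image_subset_iff add.commute)
  qed
  have sub: "T (Suc k) i \<in> subcells N (T k (i div R))" for k i
    using E(2)[OF lowT, of k "i div R"] R by (auto simp: TS image_subset_iff)
  have ext: "T k i \<in> extensional Basis" for k i
    using subcells_extensional[OF sub] by (cases k) (auto simp: T0)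
  have inj: "inj_on (T k) {..<R ^ k}" for k
  proof (induction k)
    case 0
    show ?case by (rule inj_onI) auto
  next
    case (Suc k)
    show ?case
    proof (rule inj_onI)
      fix i j assume ij: "i \<in> {..<R ^ Suc k}" "j \<in> {..<R ^ Suc k}" "T (Suc k) i = T (Suc k) j"
      have "T k (i div R) = T k (j div R)"
        using subcells_parent_unique[OF sub[of k i], of "T k (j div R)"] sub[of k j] ij ext by simp
      moreover have "i div R < R ^ k" "j div R < R ^ k"
        using ij by (auto simp: less_mult_imp_div_less mult.commute)
      ultimately have div: "i div R = j div R" using Suc by (auto dest: inj_onD)
      then have "i mod R = j mod R"
        using ij(3) E(1)[OF lowT[of k "i div R"]] R by (auto simp: TS dest: inj_onD)
      then show "i = j" using div by (metis div_mult_mod_eq)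
    qed
  qed
  \<comment> \<open>\<open>ix k y\<close> is the index given by the first \<open>k\<close> digits of \<open>y\<close> in base \<open>R\<close>.\<close>
  define ix where "ix k y = nat \<lfloor>y * real R ^ k\<rfloor>" for k and y :: real
  have ix_lt: "ix k y < R ^ k" if "y \<in> {0..<1}" for k y
  proof -
    have "y * real R ^ k < 1 * real R ^ k" using that R by (intro mult_strict_right_mono) auto
    then have "\<lfloor>y * real R ^ k\<rfloor> < int (R ^ k)" by (simp add: floor_less_iff)
    then show ?thesis unfolding ix_def using that by (subst nat_less_iff) auto
  qed
  have ix_div: "ix (Suc k) y div R = ix k y" if "y \<in> {0..<1}" for k y
  proof -
    have "\<lfloor>y * real R ^ Suc k / real_of_int (int R)\<rfloor> = \<lfloor>y * real R ^ Suc k\<rfloor> div int R"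
      by (rule floor_divide_real_eq_div) simp
    moreover have "y * real R ^ Suc k / real_of_int (int R) = y * real R ^ k" using R by simp
    ultimately have "\<lfloor>y * real R ^ k\<rfloor> = \<lfloor>y * real R ^ Suc k\<rfloor> div int R" by simp
    moreover have "0 \<le> \<lfloor>y * real R ^ Suc k\<rfloor>" using that by simp
    ultimately show ?thesis unfolding ix_def by (simp only: nat_div_distrib nat_int)
  qed
  define Q where "Q y k = cell a s (k * N) (T k (ix k y))" for y k
  have "\<exists>z. \<forall>k. z \<in> Q y k" if y: "y \<in> {0..<1}" for y
  proof -
    have "Q y (Suc k) \<subseteq> Q y k" for k
      using cell_subcells_subset[OF s sub[of k "ix (Suc k) y"], of a "k * N"] ix_div[OF y, of k]
      by (simp add: Q_def add.commute)
    then have "\<And>k l. k \<le> l \<Longrightarrow> Q y l \<subseteq> Q y k" by (rule lift_Suc_antimono_le)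
    then have "\<Inter> (range (Q y)) \<noteq> {}"
      by (intro compact_nest) (auto simp only: Q_def compact_cell cell_nonempty[OF s])
    then show ?thesis by blast
  qed
  then obtain x where "\<forall>y\<in>{0..<1}. \<forall>k. x y \<in> Q y k" by (rule bchoice[OF ballI, THEN exE])
  then have x: "x y \<in> Q y k" if "y \<in> {0..<1}" for y k using that by blast
  have xU: "x y \<notin> U p" if y: "y \<in> {0..<1}" and p: "p \<in> J" for y p
  proof
    assume xp: "x y \<in> U p"
    let ?g = "diameter (U p)"
    have g: "0 < ?g" using U p by simp
    obtain n where n: "\<gamma> * s / ?g < 2 ^ n" using real_arch_pow[of 2] by auto
    define k where "k = max n (lev p)"
    have k: "n \<le> k * N" "lev p \<le> k * N"
      using N1 mult_le_mono2[OF N1, of k] by (auto simp: k_def)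
    have "x y \<in> Q y k" using x y by blast
    then have "{p} \<subseteq> {p\<in>J. lev p \<le> k * N \<and> U p \<inter> cell a s (k * N) (T k (ix k y)) \<noteq> {}}"
      using p k xp by (auto simp: Q_def)
    from lowT[unfolded low_def, rule_format, OF _ this]
    have pw: "?g powr c \<le> (\<gamma> * (s / 2 ^ (k * N))) powr c" by simp
    have "?g \<le> \<gamma> * (s / 2 ^ (k * N))"
    proof (rule ccontr)
      assume "\<not> ?g \<le> \<gamma> * (s / 2 ^ (k * N))"
      then have "(\<gamma> * (s / 2 ^ (k * N))) powr c < ?g powr c"
        using c \<gamma> s by (intro powr_less_mono2) auto
      then show False using pw by simp
    qed
    also have "\<dots> \<le> \<gamma> * (s / 2 ^ n)"
      using \<gamma> s k by (intro mult_left_mono divide_left_mono power_increasing) auto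
    also have "\<dots> < ?g" using n g by (simp add: field_simps)
    finally show False by simp
  qed
  have xA: "x ` {0..<1} \<subseteq> A"
  proof
    fix z assume "z \<in> x ` {0..<1}"
    then obtain y where y: "y \<in> {0..<1}" "z = x y" by blast
    have "z \<in> cell a s 0 (\<lambda>b\<in>Basis. 0)" using x[OF y(1), of 0] y by (simp add: Q_def T0)
    then show "z \<in> A" using xU[OF y(1)] y A by blast
  qed
  define t where "t = real ?d - 1 / N"
  have Nt: "real N * t = real (N * ?d - 1)" using N N1 by (simp add: t_def algebra_simps of_nat_diff)
  then have "0 < real N * t" using N by simp
  then have t: "0 < t" using N1 by (simp add: zero_less_mult_iff)
  show ?thesis unfolding t_def[symmetric]
  proof (rule mass_distribution[OF xA t, of "3 ^ ?d * (2 ^ N / s) powr t"])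
    show "0 < 3 ^ ?d * (2 ^ N / s) powr t" using s by simp
    fix V :: "'a set" and \<rho> :: real assume V: "bounded V" "V \<noteq> {}" "diameter V \<le> \<rho>" "0 < \<rho>"
    have eq: "3 ^ ?d * (2 ^ N / s) powr t * \<rho> powr t = 3 ^ ?d * (2 ^ N * \<rho> / s) powr t"
      using s V by (simp add: powr_divide powr_mult)
    show "\<exists>W\<in>sets lborel. {y \<in> {0..<1}. x y \<in> V} \<subseteq> W \<and>
        emeasure lborel W \<le> ennreal (3 ^ ?d * (2 ^ N / s) powr t * \<rho> powr t)"
    proof (cases "s < \<rho>")
      case True
      have "1 * 1 \<le> 2 ^ N * (\<rho> / s)" using True s by (intro mult_mono) auto
      then have "1 * 1 \<le> 3 ^ ?d * (2 ^ N * \<rho> / s) powr t"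
        using t by (intro mult_mono ge_one_powr_ge_zero) auto
      then show ?thesis unfolding eq by (intro bexI[of _ "{0..<1}"]) auto
    next
      case False
      \<comment> \<open>Choose \<open>k\<close> with \<open>s / 2 ^ (Suc k * N) < \<rho> \<le> s / 2 ^ (k * N)\<close>.\<close>
      have "\<exists>k. s / 2 ^ (k * N) < \<rho>"
      proof -
        obtain n where n: "s / \<rho> < 2 ^ n" using real_arch_pow[of 2] by auto
        have "s / \<rho> < 2 ^ (n * N)"
        proof (rule order_less_le_trans[OF n])
          show "(2::real) ^ n \<le> 2 ^ (n * N)" using N1 mult_le_mono2[OF N1, of n] by (intro power_increasing) auto
        qed
        then show ?thesis using V by (intro exI[of _ n]) (simp add: pos_divide_less_eq mult.commute)
      qed
      moreover define k' where "k' = (LEAST k. s / 2 ^ (k * N) < \<rho>)"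
      ultimately have k': "s / 2 ^ (k' * N) < \<rho>" "\<And>k. k < k' \<Longrightarrow> \<rho> \<le> s / 2 ^ (k * N)"
        using LeastI_ex[of "\<lambda>k. s / 2 ^ (k * N) < \<rho>"] not_less_Least[of _ "\<lambda>k. s / 2 ^ (k * N) < \<rho>"]
        by (auto simp: not_less)
      then obtain k where k: "k' = Suc k" using False by (cases k') auto
      have k1: "\<rho> \<le> s / 2 ^ (k * N)" using k' k by simp
      have k2: "1 / 2 ^ (k * N) \<le> 2 ^ N * \<rho> / s"
        using k'(1) s by (simp add: k power_add field_simps)
      define I where "I = {i\<in>{..<R ^ k}. V \<inter> cell a s (k * N) (T k i) \<noteq> {}}"
      define W where "W = (\<Union>i\<in>I. {real i / R ^ k ..< (real i + 1) / R ^ k})"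
      have finI: "finite I" by (simp add: I_def)
      have cardI: "real (card I) \<le> 3 ^ ?d"
      proof -
        have "card I = card (T k ` I)"
          using inj[of k] by (intro card_image[symmetric]) (auto simp: I_def inj_on_def)
        moreover have "T k ` I \<subseteq> {w \<in> extensional Basis. V \<inter> cell a s (k * N) w \<noteq> {}}"
          using ext by (auto simp: I_def)
        ultimately have "real (card I) \<le> (diameter V / (s / 2 ^ (k * N)) + 2) ^ ?d"
          using card_cells_meeting[OF s V(1) refl, of a "k * N"]
          by (metis (no_types, lifting) card_mono of_nat_mono order_trans)
        also have "\<dots> \<le> (1 + 2) ^ ?d"
        proof (intro power_mono add_right_mono)
          show "diameter V / (s / 2 ^ (k * N)) \<le> 1"
            using V k1 s by (subst pos_divide_le_eq) auto
          show "0 \<le> diameter V / (s / 2 ^ (k * N)) + 2" using diameter_ge_0[OF V(1)] s by simp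
        qed
        finally show ?thesis by simp
      qed
      have "{y \<in> {0..<1}. x y \<in> V} \<subseteq> W"
      proof
        fix y assume "y \<in> {y \<in> {0..<1}. x y \<in> V}"
        then have y: "y \<in> {0..<1}" "x y \<in> V" by auto
        have "ix k y \<in> I" using ix_lt[OF y(1)] x[OF y(1), of k] y by (auto simp: I_def Q_def)
        moreover have "real (ix k y) \<le> y * R ^ k" "y * R ^ k < real (ix k y) + 1"
          using y R by (auto simp: ix_def of_nat_nat)
        then have "y \<in> {real (ix k y) / R ^ k ..< (real (ix k y) + 1) / R ^ k}"
          using R by (simp add: pos_divide_le_eq pos_less_divide_eq)
        ultimately show "y \<in> W" unfolding W_def by blast
      qed
      moreover have "W \<in> sets lborel" unfolding W_def using finI by (intro sets.finite_UN) auto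
      moreover have "emeasure lborel W \<le> ennreal (3 ^ ?d * (2 ^ N * \<rho> / s) powr t)"
      proof -
        have "emeasure lborel W \<le> (\<Sum>i\<in>I. emeasure lborel {real i / R ^ k ..< (real i + 1) / R ^ k})"
          unfolding W_def using finI by (intro emeasure_subadditive_finite) auto
        also have "\<dots> = (\<Sum>i\<in>I. ennreal (1 / R ^ k))"
          using R by (intro sum.cong refl) (simp add: divide_right_mono diff_divide_distrib[symmetric])
        also have "\<dots> = ennreal (\<Sum>i\<in>I. 1 / R ^ k)" by (rule sum_ennreal) simp
        also have "\<dots> \<le> ennreal (3 ^ ?d * (2 ^ N * \<rho> / s) powr t)"
        proof (rule ennreal_leI)
          have "real R = 2 powr (N * t)"
            unfolding Nt by (subst powr_realpow) (simp_all add: R_def)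
          then have "real R ^ k = 2 powr (real (k * N) * t)"
            by (simp add: powr_power mult_ac)
          also have "\<dots> = (2 ^ (k * N)) powr t"
            using powr_powr[of 2 "real (k * N)" t] powr_realpow[of 2 "k * N"] by simp
          finally have "1 / real R ^ k = (1 / 2 ^ (k * N)) powr t"
            by (simp add: powr_divide)
          also have "\<dots> \<le> (2 ^ N * \<rho> / s) powr t" using k2 t by (intro powr_mono2) auto
          finally have "1 / real R ^ k \<le> (2 ^ N * \<rho> / s) powr t" .
          then have "real (card I) * (1 / real R ^ k) \<le> 3 ^ ?d * (2 ^ N * \<rho> / s) powr t"
            using cardI by (intro mult_mono) auto
          then show "(\<Sum>i\<in>I. 1 / real (R ^ k)) \<le> 3 ^ ?d * (2 ^ N * \<rho> / s) powr t" by simp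
        qed
        finally show ?thesis .
      qed
      ultimately show ?thesis unfolding eq by blast
    qed
  qed
qed

section \<open>Choice of the constants\<close>

text \<open>
  Weighted inequality of arithmetic and geometric means for \<open>y\<close> and 1.
\<close>

lemma powr_le_affine:
  fixes y a :: real
  assumes "0 < y" "0 \<le> a" "a \<le> 1"
  shows "y powr a \<le> a * y + (1 - a)"
  using Youngs_inequality_0[of a "1 - a" y 1] assms by simp

text \<open>
  Apart from the hypothesis on \<open>S\<close> and the claimed bound, the constants enter only
  through the following crude bounds.
\<close>

lemma K2_ge:
  assumes "1 \<le> d"
  shows "81 * ((24 * sqrt d) ^ d)\<^sup>2 \<le> K2 d" "24 ^ d \<le> (24 * sqrt d) ^ d" "24 * sqrt d \<le> (24 * sqrt d) ^ d"
proof -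
  define X where "X = (24 * sqrt d) ^ d"
  have sd: "1 \<le> sqrt d" using assms by simp
  show "24 ^ d \<le> (24 * sqrt d) ^ d" using sd by (intro power_mono) auto
  show "24 * sqrt d \<le> (24 * sqrt d) ^ d" by (rule self_le_power) (use sd assms in linarith)+
  have X: "0 < X" unfolding X_def using sd by (intro zero_less_power) auto
  have "(4::real) ^ 1 \<le> 4 ^ d" using assms by (intro power_increasing) auto
  then have "X * 9 \<le> X * (1 + 4 ^ d * 2)" using X by simp
  moreover have "1 / (2::real) ^ d < 1" using assms by simp
  moreover have "X * (1 + 4 ^ d * 2) \<le> X * (1 + 4 ^ d * 2) / (1 - 1 / 2 ^ d)"
    using X \<open>1 / (2::real) ^ d < 1\<close> by (subst pos_le_divide_eq) (auto simp: algebra_simps)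
  ultimately have "9 * X \<le> X * (1 + 4 ^ d * 2) / (1 - 1 / 2 ^ d)" by linarith
  then have "(9 * X)\<^sup>2 \<le> K2 d" unfolding K2_def X_def[symmetric] using X by (intro power_mono) auto
  then show "81 * ((24 * sqrt d) ^ d)\<^sup>2 \<le> K2 d" by (simp add: X_def power_mult_distrib)
qed

lemma K1_bounds:
  assumes d: "1 \<le> d"
  shows "4 * (24 * sqrt d) ^ d \<le> K1 d" "K1 d < d * K2 d"
proof -
  define X where "X = (24 * sqrt d) ^ d"
  define L where "L = ln (16 * sqrt d)"
  define e :: real where "e = 1 - 1 / 2 ^ d"
  have sd: "1 \<le> sqrt d" using d by simp
  have X: "0 < X" "24 * sqrt d \<le> X" "81 * X\<^sup>2 \<le> K2 d"
    unfolding X_def using sd K2_ge[OF d] by (auto intro!: zero_less_power)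
  have "(2::real) ^ 1 \<le> 2 ^ d" using d by (intro power_increasing) auto
  then have "1 / 2 ^ d \<le> 1 / (2::real)" by (simp add: field_simps)
  moreover have "0 < 1 / (2::real) ^ d" by simp
  ultimately have e: "1 / 2 \<le> e" "e \<le> 1" by (auto simp only: e_def)
  have "exp (2::real) = exp 1 * exp 1" by (simp add: exp_add[symmetric])
  also have "\<dots> \<le> 3 * 3" using exp_le by (intro mult_mono) auto
  also have "\<dots> \<le> 16 * sqrt d" using sd by linarith
  finally have "exp 2 \<le> 16 * sqrt d" .
  then have L2: "2 \<le> L" unfolding L_def using sd by (subst ln_ge_iff) auto
  have L_le: "L \<le> 16 * sqrt d" unfolding L_def using sd ln_le_minus_one[of "16 * sqrt d"] by simp
  have K1: "K1 d = 2 * d * X * L / e" by (simp add: K1_def X_def L_def e_def)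
  have "2 * 1 * X * 2 \<le> 2 * d * X * L" using X L2 d by (intro mult_mono) auto
  also have "\<dots> \<le> K1 d" unfolding K1 using e X L2 mult_left_mono[of e 1 "2 * d * X * L"] by (subst pos_le_divide_eq) auto
  finally show "4 * (24 * sqrt d) ^ d \<le> K1 d" by (simp add: X_def)
  have "K1 d \<le> 4 * d * X * L"
  proof -
    have "2 * d * X * L * 1 \<le> 2 * d * X * L * (2 * e)" using e X L2 by (intro mult_left_mono) auto
    then show ?thesis unfolding K1 using e by (subst pos_divide_le_eq) (auto simp: algebra_simps)
  qed
  also have "\<dots> \<le> 4 * d * X * X"
  proof (rule mult_left_mono)
    show "L \<le> X" using X L_le sd by linarith
  qed (use X in simp)
  also have "\<dots> < d * (81 * X\<^sup>2)" using X d by (simp add: power2_eq_square)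
  also have "\<dots> \<le> d * K2 d" using X by (intro mult_left_mono) auto
  finally show "K1 d < d * K2 d" .
qed

lemma K2_ge_1: "1 \<le> d \<Longrightarrow> 1 \<le> K2 d"
proof -
  assume d: "1 \<le> d"
  have "1 \<le> sqrt d" using d by simp
  then have "1 \<le> (24 * sqrt d) ^ d" using K2_ge(3)[OF d] by linarith
  then have "1 \<le> ((24 * sqrt d) ^ d)\<^sup>2" by (rule one_le_power)
  then show ?thesis using K2_ge(1)[OF d] by linarith
qed

text \<open>
  A bound for \<open>S\<close> independent of \<open>\<beta>\<close>. It allows the construction
  to subdivide dyadically, whatever the size of \<open>\<beta>\<close>; the factor \<open>d -
  c\<close> compensates for the geometric series with ratio \<open>2 powr (c - d)\<close>.
\<close>

lemma small_condition:
  fixes c \<beta> S :: real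
  assumes d: "1 \<le> d" and c: "0 < c" "c < real d" and \<beta>: "0 < \<beta>" "\<beta> \<le> 1"
    and S: "0 \<le> S" "S \<le> 1 / K2 d * \<beta> powr c * (1 - \<beta> powr (real d - c))"
  shows "S \<le> (real d - c) / d / K2 d"
proof -
  have K2: "0 < K2 d" using K2_ge_1[OF d] by simp
  have "\<beta> powr c = (\<beta> powr d) powr (c / d)" using d by (simp add: powr_powr)
  also have "\<dots> \<le> c / d * \<beta> powr d + (1 - c / d)" using c \<beta> by (intro powr_le_affine) auto
  also have "c / d * \<beta> powr d \<le> 1 * \<beta> powr d" using c by (intro mult_right_mono) auto
  finally have "\<beta> powr c \<le> \<beta> powr d + (1 - c / d)" by simp
  moreover have "\<beta> powr c * (1 - \<beta> powr (real d - c)) = \<beta> powr c - \<beta> powr d"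
    using \<beta> by (simp add: right_diff_distrib powr_add[symmetric])
  ultimately have "\<beta> powr c * (1 - \<beta> powr (real d - c)) \<le> 1 - c / d" by linarith
  also have "\<dots> = (real d - c) / d" using d by (simp add: diff_divide_distrib)
  finally have "1 / K2 d * (\<beta> powr c * (1 - \<beta> powr (real d - c))) \<le> 1 / K2 d * ((real d - c) / d)"
    using K2 by (intro mult_left_mono) auto
  then show ?thesis using S by (simp add: mult.commute)
qed

text \<open>
  The smallness condition of \<open>card_not_low\<close> for \<open>\<gamma> = 1 / 24\<close>.
  Each of the four summands is at most \<open>1 / 8\<close>; the lower bound for
  \<open>N\<close> serves the second one, the upper bound the third.
\<close>

lemma scale_condition:
  fixes c S :: real
  assumes d: "1 \<le> d" and c: "0 < c" "c < real d"
    and S: "0 \<le> S" "S \<le> (real d - c) / d / K2 d"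
    and N: "(2 * real d + 3) / (real d - c) \<le> N" "real N * (8 * (6 * sqrt d) ^ d * S powr (d / c)) \<le> 1"
  defines "\<alpha> \<equiv> 2 * sqrt d * S powr (1 / c)" and "q \<equiv> 2 powr (c - real d)"
  shows "3 ^ d * ((1 / 24) ^ d + q ^ N + N * \<alpha> ^ d + (\<alpha> / (1 / 24)) powr c / (1 - q)) \<le> 1 / 2"
proof -
  define a where "a = (real d - c) / d"
  define X where "X = (24 * sqrt d) ^ d"
  have sd: "1 \<le> sqrt d" using d by simp
  have X: "0 < X" "24 ^ d \<le> X" "81 * X\<^sup>2 \<le> K2 d"
    unfolding X_def using sd K2_ge[OF d] by (auto intro!: zero_less_power)
  have K2: "0 < K2 d" by (rule less_le_trans[OF _ X(3)]) (use X in simp)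
  have a: "0 < a" "a < 1" using c d by (auto simp: a_def field_simps)
  have p1: "3 ^ d * (1 / 24) ^ d \<le> (1 / 8 :: real)"
  proof -
    have "3 ^ d * (1 / 24) ^ d = (1 / 8 :: real) ^ d"
      using power_mult_distrib[of "3::real" "1 / 24" d] by simp
    also have "\<dots> \<le> (1 / 8) ^ 1" using d by (intro power_decreasing) auto
    finally show ?thesis by simp
  qed
  have p2: "3 ^ d * q ^ N \<le> 1 / 8"
  proof -
    have "(2 * real d + 3) \<le> N * (real d - c)" using N(1) c by (simp add: pos_divide_le_eq)
    then have "2 * real d + N * (c - d) \<le> -3" by (simp add: algebra_simps)
    then have le: "2 powr (2 * real d) * 2 powr (N * (c - d)) \<le> 2 powr (-3)"
      unfolding powr_add[symmetric] by (rule powr_mono) simp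
    have qN: "q ^ N = 2 powr (N * (c - d))" by (simp add: q_def powr_power mult.commute)
    have "(3::real) ^ d \<le> 2 powr (2 * real d)"
    proof -
      have "(3::real) ^ d \<le> 4 ^ d" by (intro power_mono) auto
      also have "\<dots> = (2 powr 2) ^ d" by simp
      also have "\<dots> = 2 powr (2 * real d)" using powr_powr[of 2 2 "real d"] by (simp add: powr_realpow)
      finally show ?thesis .
    qed
    then have "3 ^ d * 2 powr (N * (c - d)) \<le> 2 powr (2 * real d) * 2 powr (N * (c - d))"
      by (rule mult_right_mono) simp
    then have "3 ^ d * q ^ N \<le> 2 powr (-3)" unfolding qN using le by (rule order_trans)
    also have "(2::real) powr (-3) = 1 / 8" using powr_realpow[of 2 3] powr_minus_divide[of "2::real" 3] by simp
    finally show ?thesis .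
  qed
  have p3: "3 ^ d * (N * \<alpha> ^ d) \<le> 1 / 8"
  proof -
    have "(S powr (1 / c)) ^ d = S powr (d / c)" using d by (cases "S = 0") (simp_all add: powr_power)
    then have "\<alpha> ^ d = (2 * sqrt d) ^ d * S powr (d / c)"
      unfolding \<alpha>_def by (simp only: power_mult_distrib)
    then have "3 ^ d * (N * \<alpha> ^ d) = N * ((3 ^ d * (2 * sqrt d) ^ d) * S powr (d / c))"
      by (simp only: mult_ac)
    also have "3 ^ d * (2 * sqrt d) ^ d = (3 * (2 * sqrt d)) ^ d" by (rule power_mult_distrib[symmetric])
    also have "3 * (2 * sqrt d) = 6 * sqrt d" by simp
    also have "N * ((6 * sqrt d) ^ d * S powr (d / c)) \<le> 1 / 8"
      using N(2) by (simp only: mult.assoc mult.left_commute[of _ 8])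
    finally show ?thesis .
  qed
  have p4: "3 ^ d * ((\<alpha> / (1 / 24)) powr c / (1 - q)) \<le> 1 / 8"
  proof -
    have "q = (2 powr (- real d)) powr a" using d by (simp add: q_def a_def powr_powr)
    also have "\<dots> \<le> a * 2 powr (- real d) + (1 - a)" using a by (intro powr_le_affine) auto
    also have "a * 2 powr (- real d) \<le> a * 2 powr (-1)" using a d by (intro mult_left_mono powr_mono) auto
    finally have q: "a / 2 \<le> 1 - q" by (simp add: powr_minus)
    have "(\<alpha> / (1 / 24)) powr c = (48 * sqrt d) powr c * S"
    proof -
      have "\<alpha> / (1 / 24) = (48 * sqrt d) * S powr (1 / c)" by (simp add: \<alpha>_def)
      then show ?thesis using S c by (simp add: powr_mult powr_powr)
    qed
    also have "\<dots> \<le> (48 * sqrt d) powr d * (a / K2 d)"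
    proof (intro mult_mono powr_mono)
      show "1 \<le> 48 * sqrt d" using sd by linarith
    qed (use S c in \<open>simp_all add: a_def\<close>)
    also have "(48 * sqrt d) powr d = 2 ^ d * X"
    proof -
      have "(48 * sqrt d) powr d = (48 * sqrt d) ^ d" by (rule powr_realpow) (use sd in linarith)
      also have "\<dots> = 2 ^ d * X"
        unfolding X_def power_mult_distrib[symmetric] by simp
      finally show ?thesis .
    qed
    finally have "(\<alpha> / (1 / 24)) powr c / (1 - q) \<le> (2 ^ d * X * (a / K2 d)) / (a / 2)"
      using q a X K2 by (intro frac_le) auto
    also have "\<dots> = 2 * 2 ^ d * X / K2 d" using a by simp
    finally have "3 ^ d * ((\<alpha> / (1 / 24)) powr c / (1 - q)) \<le> 3 ^ d * (2 * 2 ^ d * X / K2 d)"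
      by (intro mult_left_mono) auto
    also have "\<dots> = 2 * 6 ^ d * X / K2 d"
    proof -
      have "(6::real) ^ d = 3 ^ d * 2 ^ d" using power_mult_distrib[of "3::real" 2 d] by simp
      then show ?thesis by simp
    qed
    also have "\<dots> \<le> 1 / 8"
    proof -
      have "(6::real) ^ d \<le> 24 ^ d" by (intro power_mono) auto
      then have "16 * 6 ^ d * X \<le> 81 * X * X" using X by (intro mult_right_mono) auto
      also have "\<dots> \<le> K2 d" using X(3) by (simp add: power2_eq_square)
      finally have "16 * 6 ^ d * X \<le> K2 d" .
      then show ?thesis using K2 by (simp add: pos_divide_le_eq)
    qed
    finally show ?thesis .
  qed
  show ?thesis unfolding distrib_left using p1 p2 p3 p4 by linarith
qed

text \<open>
  The gaps of level 0 have diameters at most \<open>D / \<tau>\<close>; this makes the initial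
  cell, of side \<open>r / (2 * sqrt d)\<close>, low. It is the only place where the size of the
  sets relative to the ball, and thus \<open>\<beta>\<close>, enters the construction.
\<close>

lemma start_condition:
  fixes c \<beta> S D r :: real
  assumes d: "1 \<le> d" and c: "0 < c" "c < real d" and \<beta>: "0 < \<beta>"
    and S: "0 \<le> S" "S \<le> \<beta> powr c / K2 d"
    and r: "0 < r" and D: "0 \<le> D" "D \<le> 2 * r / \<beta>"
  shows "S * D powr c \<le> (1 / 24 * (r / (2 * sqrt d))) powr c"
proof -
  define X where "X = (24 * sqrt d) ^ d"
  have sd: "1 \<le> sqrt d" using d by simp
  have K2: "1 \<le> K2 d" by (rule K2_ge_1[OF d])
  have "(96 * sqrt d) powr c \<le> (96 * sqrt d) powr d"
    by (rule powr_mono) (use sd c in linarith)+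
  also have "\<dots> = (4 * (24 * sqrt d)) ^ d"
    using sd by (subst powr_realpow) (linarith, simp)
  also have "\<dots> = 4 ^ d * X" unfolding X_def by (rule power_mult_distrib)
  also have "\<dots> \<le> X * X"
  proof (rule mult_right_mono)
    have "(4::real) ^ d \<le> 24 ^ d" by (intro power_mono) auto
    then show "4 ^ d \<le> X" using K2_ge(2)[OF d] unfolding X_def by linarith
    show "0 \<le> X" unfolding X_def using sd by (intro zero_le_power) auto
  qed
  also have "X * X \<le> 81 * (X * X)" by simp
  also have "\<dots> \<le> K2 d" using K2_ge(1)[OF d] unfolding X_def[symmetric] power2_eq_square .
  finally have K: "(96 * sqrt d) powr c \<le> K2 d" .
  have "S * D powr c \<le> \<beta> powr c / K2 d * (2 * r / \<beta>) powr c"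
    using S D c by (intro mult_mono powr_mono2) auto
  also have "\<dots> = (2 * r) powr c / K2 d" using \<beta> r by (simp add: powr_divide)
  also have "\<dots> \<le> (2 * r) powr c / (96 * sqrt d) powr c"
    using K K2 sd d by (intro divide_left_mono mult_pos_pos) auto
  also have "\<dots> = (2 * r / (96 * sqrt d)) powr c" by (rule powr_divide[symmetric])
  also have "2 * r / (96 * sqrt d) = 1 / 24 * (r / (2 * sqrt d))" by simp
  finally show ?thesis .
qed

text \<open>
  The loss of dimension in the construction is at most the one claimed, since \<open>\<beta> ^ d
  * \<bar>ln \<beta>\<bar> \<le> 1\<close>; and the claimed one is smaller than
  \<open>d\<close>.
\<close>

lemma loss_bounds:
  fixes c \<beta> S :: real
  assumes d: "1 \<le> d" and c: "0 < c" "c < real d" and \<beta>: "0 < \<beta>" "\<beta> \<le> 1 / 4"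
    and S: "0 \<le> S" "S \<le> \<beta> powr c / K2 d"
  defines "\<sigma> \<equiv> S powr (d / c)"
  shows "16 * (6 * sqrt d) ^ d * \<sigma> \<le> K1 d * (\<sigma> / (\<beta> ^ d * \<bar>ln \<beta>\<bar>))"
    and "K1 d * (\<sigma> / (\<beta> ^ d * \<bar>ln \<beta>\<bar>)) < d"
proof -
  define Z where "Z = (6 * sqrt d) ^ d"
  have sd: "1 \<le> sqrt d" using d by simp
  have \<sigma>: "0 \<le> \<sigma>" by (simp add: \<sigma>_def)
  have K2: "1 \<le> K2 d" by (rule K2_ge_1[OF d])
  have Z: "0 < Z" unfolding Z_def using sd by (intro zero_less_power) auto
  have X: "4 ^ d * Z = (24 * sqrt d) ^ d"
    unfolding Z_def power_mult_distrib[symmetric] by simp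
  have K1: "16 * Z \<le> K1 d"
  proof -
    have "(4::real) ^ 1 \<le> 4 ^ d" using d by (intro power_increasing) auto
    then have "4 * Z \<le> 4 ^ d * Z" using Z by (intro mult_right_mono) auto
    then show ?thesis using K1_bounds(1)[OF d] unfolding X[symmetric] by linarith
  qed
  have "exp (1::real) \<le> 4" using exp_le by linarith
  also have "4 \<le> 1 / \<beta>" using \<beta> by (simp add: field_simps)
  finally have "1 \<le> ln (1 / \<beta>)" using \<beta> by (subst ln_ge_iff) auto
  then have ln1: "1 \<le> \<bar>ln \<beta>\<bar>" using \<beta> by (simp add: ln_div)
  have "\<bar>ln \<beta>\<bar> = ln (1 / \<beta>)" using \<beta> by (simp add: ln_div)
  also have "\<dots> \<le> 1 / \<beta> - 1" using \<beta> by (intro ln_le_minus_one) auto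
  finally have "\<beta> * \<bar>ln \<beta>\<bar> \<le> \<beta> * (1 / \<beta> - 1)" using \<beta> by (intro mult_left_mono) auto
  also have "\<dots> \<le> 1" using \<beta> by (simp add: right_diff_distrib)
  finally have "\<beta> * \<bar>ln \<beta>\<bar> \<le> 1" .
  moreover have "\<beta> ^ d \<le> \<beta> ^ 1" using \<beta> d by (intro power_decreasing) auto
  then have "\<beta> ^ d * \<bar>ln \<beta>\<bar> \<le> \<beta> * \<bar>ln \<beta>\<bar>" by (intro mult_right_mono) auto
  ultimately have le1: "\<beta> ^ d * \<bar>ln \<beta>\<bar> \<le> 1" by linarith
  have den: "0 < \<beta> ^ d * \<bar>ln \<beta>\<bar>" using \<beta> ln1 by (intro mult_pos_pos) auto
  have "16 * Z * \<sigma> \<le> K1 d * (\<sigma> / (\<beta> ^ d * \<bar>ln \<beta>\<bar>))"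
  proof (rule mult_mono[OF K1])
    show "\<sigma> \<le> \<sigma> / (\<beta> ^ d * \<bar>ln \<beta>\<bar>)"
      using den le1 \<sigma> by (subst pos_le_divide_eq) (auto intro: mult_left_le)
  qed (use K1 Z \<sigma> in auto)
  then show "16 * (6 * sqrt d) ^ d * \<sigma> \<le> K1 d * (\<sigma> / (\<beta> ^ d * \<bar>ln \<beta>\<bar>))" by (simp add: Z_def)
  have "\<sigma> \<le> (\<beta> powr c / K2 d) powr (d / c)"
    unfolding \<sigma>_def using S c by (intro powr_mono2) auto
  also have "\<dots> = \<beta> powr d * (1 / K2 d) powr (d / c)"
    using c by (simp add: powr_divide powr_powr)
  also have "\<dots> \<le> \<beta> powr d * (1 / K2 d) powr 1"
    using K2 c by (intro mult_left_mono powr_mono') (auto simp: field_simps)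
  also have "\<dots> = \<beta> ^ d / K2 d" using \<beta> K2 by (simp add: powr_realpow)
  finally have "\<sigma> / (\<beta> ^ d * \<bar>ln \<beta>\<bar>) \<le> (\<beta> ^ d / K2 d) / (\<beta> ^ d * 1)"
    using ln1 \<beta> \<sigma> by (intro frac_le mult_left_mono) auto
  then have "\<sigma> / (\<beta> ^ d * \<bar>ln \<beta>\<bar>) \<le> 1 / K2 d" using \<beta> by simp
  moreover have "0 \<le> K1 d" using K1 Z by linarith
  ultimately have "K1 d * (\<sigma> / (\<beta> ^ d * \<bar>ln \<beta>\<bar>)) \<le> K1 d * (1 / K2 d)"
    by (rule mult_left_mono)
  also have "\<dots> < d" using K1_bounds(2)[OF d] K2 by (simp add: pos_divide_less_eq)
  finally show "K1 d * (\<sigma> / (\<beta> ^ d * \<bar>ln \<beta>\<bar>)) < d" .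
qed

text \<open>
  The bounds required of \<open>N\<close> are compatible for \<open>S > 0\<close>, and
  \<open>N\<close> can be chosen of the order of \<open>S powr (- d / c)\<close>.
\<close>

lemma exists_scale:
  fixes c S :: real
  assumes d: "1 \<le> d" and c: "0 < c" "c < real d"
    and S: "0 < S" "S \<le> (real d - c) / d / K2 d"
  shows "\<exists>N::nat. (2 * real d + 3) / (real d - c) \<le> N \<and>
    real N * (8 * (6 * sqrt d) ^ d * S powr (d / c)) \<le> 1 \<and>
    1 / real N \<le> 16 * (6 * sqrt d) ^ d * S powr (d / c)"
proof -
  define Z where "Z = (6 * sqrt d) ^ d"
  define \<sigma> where "\<sigma> = S powr (d / c)"
  define y where "y = 1 / (8 * Z * \<sigma>)"
  have sd: "1 \<le> sqrt d" using d by simp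
  have K2: "1 \<le> K2 d" by (rule K2_ge_1[OF d])
  have Z: "0 < Z" unfolding Z_def using sd by (intro zero_less_power) auto
  have \<sigma>: "0 < \<sigma>" using S by (simp add: \<sigma>_def)
  have y: "0 < y" using Z \<sigma> by (simp add: y_def)
  have X: "4 ^ d * Z = (24 * sqrt d) ^ d"
    unfolding Z_def power_mult_distrib[symmetric] by simp
  have K2Z: "80 * Z \<le> K2 d"
  proof -
    have "(1::real) \<le> 4 ^ d" "(1::real) \<le> 24 ^ d" by simp_all
    then have Xs: "1 * Z \<le> 4 ^ d * Z" "1 \<le> (24 * sqrt d) ^ d"
      using Z order_trans[OF _ K2_ge(2)[OF d]] by (blast intro: mult_right_mono order_less_imp_le)+
    have "(24 * sqrt d) ^ d * 1 \<le> (24 * sqrt d) ^ d * (24 * sqrt d) ^ d"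
      using Xs by (intro mult_left_mono) auto
    then have "Z \<le> ((24 * sqrt d) ^ d)\<^sup>2" using Xs X unfolding power2_eq_square by linarith
    then show ?thesis using K2_ge(1)[OF d] Z by linarith
  qed
  have "(real d - c) / d / K2 d \<le> 1 / 1" using c d K2 by (intro frac_le) auto
  then have "S \<le> 1" using S by simp
  then have "\<sigma> \<le> S powr 1" unfolding \<sigma>_def using S c by (intro powr_mono') auto
  then have \<sigma>_le: "\<sigma> \<le> (real d - c) / d / K2 d" using S by simp
  have "(2 * real d + 3) / (real d - c) \<le> y / 2"
  proof -
    have "16 * Z * \<sigma> * (2 * real d + 3) \<le> 16 * Z * ((real d - c) / d / K2 d) * (5 * d)"
      using \<sigma>_le Z \<sigma> d c K2 by (intro mult_mono) auto
    also have "\<dots> = 80 * Z / K2 d * (real d - c)" using d by simp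
    also have "\<dots> \<le> 1 * (real d - c)" using K2Z K2 c by (intro mult_right_mono) auto
    finally show ?thesis using Z \<sigma> c unfolding y_def by (simp add: field_simps)
  qed
  moreover have "1 \<le> (2 * real d + 3) / (real d - c)" using c by (simp add: pos_le_divide_eq)
  ultimately have y2: "(2 * real d + 3) / (real d - c) \<le> y / 2" "1 \<le> y / 2" by linarith+
  define N where "N = nat \<lfloor>y\<rfloor>"
  have N: "real N \<le> y" "y / 2 \<le> real N"
    using y y2 unfolding N_def by linarith+
  have "real N * (8 * Z * \<sigma>) \<le> y * (8 * Z * \<sigma>)" using N Z \<sigma> by (intro mult_right_mono) auto
  also have "\<dots> = 1" using Z \<sigma> by (simp add: y_def)
  finally have 1: "real N * (8 * Z * \<sigma>) \<le> 1" .
  have "1 / real N \<le> 1 / (y / 2)" using N y by (intro divide_left_mono) auto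
  also have "\<dots> = 16 * Z * \<sigma>" using Z \<sigma> by (simp add: y_def)
  finally have 2: "1 / real N \<le> 16 * Z * \<sigma>" .
  have "(2 * real d + 3) / (real d - c) \<le> N" using N(2) y2(1) by linarith
  then show ?thesis using 1 2 unfolding Z_def \<sigma>_def by blast
qed

section \<open>Intersections of thick sets\<close>

text \<open>
  The first level at which the diameter \<open>sqrt (DIM('a)) * (s / 2 ^ n)\<close> of a cell is
  less than \<open>\<tau>\<close> times the diameter of the gap \<open>G\<close>. From this
  level on, a cell meeting \<open>G\<close> meets no other gap of the same set that is at least
  as large.
\<close>

definition gap_level :: "real \<Rightarrow> real \<Rightarrow> 'a::euclidean_space set \<Rightarrow> nat" where
  "gap_level s \<tau> G = (LEAST n. sqrt (DIM('a)) * (s / 2 ^ n) < \<tau> * diameter G)"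

lemma gap_level_bounds:
  fixes G :: "'a::euclidean_space set"
  assumes "0 < \<tau>" "0 < diameter G" "0 < s"
  shows "sqrt (DIM('a)) * (s / 2 ^ gap_level s \<tau> G) < \<tau> * diameter G"
    and "1 \<le> gap_level s \<tau> G \<Longrightarrow> \<tau> * diameter G \<le> 2 * sqrt (DIM('a)) * (s / 2 ^ gap_level s \<tau> G)"
proof -
  let ?P = "\<lambda>n. sqrt (DIM('a)) * (s / 2 ^ n) < \<tau> * diameter G"
  obtain n where "sqrt (DIM('a)) * s / (\<tau> * diameter G) < 2 ^ n"
    using real_arch_pow[of 2] by auto
  then have "?P n" using assms by (simp add: field_simps)
  then show "?P (gap_level s \<tau> G)" unfolding gap_level_def by (rule LeastI)
  assume "1 \<le> gap_level s \<tau> G"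
  then obtain m where m: "gap_level s \<tau> G = Suc m" by (cases "gap_level s \<tau> G") auto
  then have "\<not> ?P m" unfolding gap_level_def by (intro not_less_Least) simp
  then show "\<tau> * diameter G \<le> 2 * sqrt (DIM('a)) * (s / 2 ^ gap_level s \<tau> G)"
    by (simp add: m not_less)
qed

text \<open>
  With \<open>F\<close> a family of gaps indexed by the sets that they belong to, at most one
  from each set.
\<close>

lemma sum_gap_powr_le:
  fixes \<tau> :: "'i \<Rightarrow> real"
  assumes S: "((\<lambda>i. \<tau> i powr (- c)) has_sum S) I" and c: "0 < c"
    and F: "finite F" "inj_on fst F" "fst ` F \<subseteq> I"
    and L: "0 \<le> L" and g: "\<And>p. p \<in> F \<Longrightarrow> 0 < \<tau> (fst p) \<and> 0 < h p \<and> \<tau> (fst p) * h p \<le> L"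
  shows "(\<Sum>p\<in>F. h p powr c) \<le> L powr c * S"
proof -
  have "(\<Sum>p\<in>F. h p powr c) \<le> (\<Sum>p\<in>F. L powr c * \<tau> (fst p) powr (- c))"
  proof (rule sum_mono)
    fix p assume p: "p \<in> F"
    have "h p \<le> L / \<tau> (fst p)" using g[OF p] by (simp add: pos_le_divide_eq mult.commute)
    then have "h p powr c \<le> (L / \<tau> (fst p)) powr c" using g[OF p] c by (intro powr_mono2) auto
    also have "\<dots> = L powr c * \<tau> (fst p) powr (- c)" by (simp add: powr_divide powr_minus_divide)
    finally show "h p powr c \<le> L powr c * \<tau> (fst p) powr (- c)" .
  qed
  also have "\<dots> = L powr c * (\<Sum>i\<in>fst ` F. \<tau> i powr (- c))"
    by (simp add: sum.reindex[OF F(2)] sum_distrib_left)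
  also have "(\<Sum>i\<in>fst ` F. \<tau> i powr (- c)) \<le> S"
    by (rule finite_sum_le_has_sum[OF S]) (use F in auto)
  finally show ?thesis by (simp add: mult_left_mono)
qed

lemma cell_0_subset_cball:
  fixes x :: "'a::euclidean_space"
  assumes "0 < s"
  shows "cell x s 0 (\<lambda>b\<in>Basis. 0) \<subseteq> cball x (sqrt (DIM('a)) * s)"
proof
  fix y assume y: "y \<in> cell x s 0 (\<lambda>b\<in>Basis. 0)"
  have "x \<in> cell x s 0 (\<lambda>b\<in>Basis. 0)" using assms by (auto simp: cell_def)
  from dist_le_cell[OF this y] show "y \<in> cball x (sqrt (DIM('a)) * s)" by simp
qed

text \<open>
  The gaps of all the sets form a family to which \<open>hausdorff_dim_ge\<close> applies, with
  \<open>\<alpha> = 2 * sqrt (DIM('a)) * S powr (1 / c)\<close>: a cell meets at most one gap of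
  its own level from each set.
\<close>

proposition hausdorff_dim_avoiding_gaps:
  fixes C :: "'i \<Rightarrow> 'a::euclidean_space set" and \<tau> :: "'i \<Rightarrow> real" and A :: "'a set"
    and x :: 'a and c s D S :: real and N :: nat
  assumes c: "0 < c" "c < DIM('a)" and s: "0 < s" and D: "0 \<le> D"
    and cl: "\<And>i. i \<in> I \<Longrightarrow> closed (C i)"
    and \<tau>: "\<And>i. i \<in> I \<Longrightarrow> gaps (C i) \<noteq> {} \<Longrightarrow> 0 < \<tau> i"
    and ext: "\<And>i G. i \<in> I \<Longrightarrow> G \<in> gaps (C i) \<Longrightarrow> \<tau> i * diameter G \<le> D"
    and sep: "\<And>i G G'. i \<in> I \<Longrightarrow> G \<in> gaps (C i) \<Longrightarrow> G' \<in> gaps (C i) \<Longrightarrow> G \<noteq> G' \<Longrightarrow>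
      diameter G \<le> diameter G' \<Longrightarrow> \<tau> i * diameter G \<le> setdist G G'"
    and S: "((\<lambda>i. \<tau> i powr (- c)) has_sum S) I" "S \<le> (real DIM('a) - c) / DIM('a) / K2 DIM('a)"
    and start: "S * D powr c \<le> (1 / 24 * s) powr c"
    and N: "(2 * real DIM('a) + 3) / (real DIM('a) - c) \<le> N"
      "real N * (8 * (6 * sqrt DIM('a)) ^ DIM('a) * S powr (DIM('a) / c)) \<le> 1"
    and A: "cell x s 0 (\<lambda>b\<in>Basis. 0) - (\<Union>i\<in>I. \<Union>(gaps (C i))) \<subseteq> A"
  shows "ereal (real DIM('a) - 1 / N) \<le> hausdorff_dim A"
proof -
  let ?d = "DIM('a)"
  define J where "J = (SIGMA i:I. gaps (C i))"
  define lev where "lev p = gap_level s (\<tau> (fst p)) (snd p :: 'a set)" for p :: "'i \<times> 'a set"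
  define \<alpha> where "\<alpha> = 2 * sqrt ?d * S powr (1 / c)"
  have S0: "0 \<le> S" by (rule has_sum_nonneg[OF S(1)]) simp
  have J: "fst p \<in> I" "snd p \<in> gaps (C (fst p))" "0 < \<tau> (fst p)" "0 < diameter (snd p)"
    "bounded (snd p)" if "p \<in> J" for p
  proof -
    show iG: "fst p \<in> I" "snd p \<in> gaps (C (fst p))" using that by (auto simp: J_def)
    show "0 < \<tau> (fst p)" using \<tau>[OF iG(1)] iG(2) by blast
    show "0 < diameter (snd p)" by (rule gap_diameter_pos[OF cl[OF iG(1)] iG(2)])
    show "bounded (snd p)" using gapsD[OF iG(2)] by blast
  qed
  have inj: "inj_on fst F" if F: "F \<subseteq> {p\<in>J. lev p = n \<and> snd p \<inter> cell x s n v \<noteq> {}}" for F n v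
  proof -
    have False if pq: "p \<in> F" "q \<in> F" "fst p = fst q" "snd p \<noteq> snd q" "diameter (snd p) \<le> diameter (snd q)" for p q
    proof -
      have pJ: "p \<in> J" "lev p = n" and qJ: "q \<in> J" using pq F by auto
      obtain y z where yz: "y \<in> snd p" "y \<in> cell x s n v" "z \<in> snd q" "z \<in> cell x s n v"
        using pq F by blast
      have "\<tau> (fst p) * diameter (snd p) \<le> setdist (snd p) (snd q)"
        using sep[OF J(1)[OF pJ(1)] J(2)[OF pJ(1)] _ pq(4,5)] J(2)[OF qJ] pq(3) by simp
      also have "\<dots> \<le> dist y z" by (rule setdist_le_dist[OF yz(1,3)])
      also have "\<dots> \<le> sqrt ?d * (s / 2 ^ n)" by (rule dist_le_cell[OF yz(2,4)])
      also have "\<dots> < \<tau> (fst p) * diameter (snd p)"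
        using gap_level_bounds(1)[OF J(3,4)[OF pJ(1)] s] pJ(2) by (simp add: lev_def)
      finally show False by simp
    qed
    then show ?thesis by (intro inj_onI) (metis linear prod.expand)
  qed
  show ?thesis
  proof (rule hausdorff_dim_ge[where J = J and U = snd and lev = lev and c = c and \<alpha> = \<alpha> and \<gamma> = "1 / 24"])
    show "0 \<le> \<alpha>" by (simp add: \<alpha>_def)
    show "(\<Sum>p\<in>F. diameter (snd p) powr c) \<le> (\<alpha> * (s / 2 ^ n)) powr c"
      if F: "finite F" "1 \<le> n" "F \<subseteq> {p\<in>J. lev p = n \<and> snd p \<inter> cell x s n v \<noteq> {}}" for n v F
    proof -
      have "(\<Sum>p\<in>F. diameter (snd p) powr c) \<le> (2 * sqrt ?d * (s / 2 ^ n)) powr c * S"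
      proof (rule sum_gap_powr_le[OF S(1) c(1) F(1) inj[OF F(3)]])
        fix p assume "p \<in> F"
        then have p: "p \<in> J" "lev p = n" using F(3) by auto
        then show "0 < \<tau> (fst p) \<and> 0 < diameter (snd p) \<and>
            \<tau> (fst p) * diameter (snd p) \<le> 2 * sqrt ?d * (s / 2 ^ n)"
          using gap_level_bounds(2)[OF J(3,4)[OF p(1)] s] J[OF p(1)] F(2) by (simp add: lev_def)
      qed (use F J s in auto)
      also have "(2 * sqrt ?d * (s / 2 ^ n)) powr c * S = (\<alpha> * (s / 2 ^ n)) powr c"
        using S0 c by (simp add: \<alpha>_def powr_mult powr_divide powr_powr)
      finally show ?thesis .
    qed
    show "(\<Sum>p\<in>F. diameter (snd p) powr c) \<le> (1 / 24 * s) powr c"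
      if F: "finite F" "F \<subseteq> {p\<in>J. lev p = 0 \<and> snd p \<inter> cell x s 0 (\<lambda>b\<in>Basis. 0) \<noteq> {}}" for F
    proof -
      have "(\<Sum>p\<in>F. diameter (snd p) powr c) \<le> D powr c * S"
        by (rule sum_gap_powr_le[OF S(1) c(1) F(1) inj[OF F(2)]]) (use F J ext D in auto)
      then show ?thesis using start by (simp add: mult.commute)
    qed
    show "3 ^ ?d * ((1 / 24) ^ ?d + (2 powr (c - ?d)) ^ N + N * \<alpha> ^ ?d
        + (\<alpha> / (1 / 24)) powr c / (1 - 2 powr (c - ?d))) \<le> 1 / 2"
      unfolding \<alpha>_def by (rule scale_condition[OF _ c S0 S(2) N]) simp
    have "2 * real ?d + 3 \<le> N * (real ?d - c)" using N(1) c by (simp add: pos_divide_le_eq)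
    also have "\<dots> \<le> N * real ?d" using c by (intro mult_left_mono) auto
    finally have "2 \<le> real (N * ?d)" by simp
    then show "2 \<le> N * ?d" by (metis of_nat_le_iff of_nat_numeral)
    show "cell x s 0 (\<lambda>b\<in>Basis. 0) - (\<Union>p\<in>J. snd p) \<subseteq> A"
      using A by (auto simp: J_def)
  qed (use s c J in auto)
qed

text \<open>
  It remains to see that the initial cell lies in \<open>B\<close>, that a point of
  \<open>B\<close> outside all gaps belongs to all sets, and to choose \<open>N\<close>.
\<close>

theorem theorem6:
  fixes C :: "'i \<Rightarrow> 'a::euclidean_space set" and I :: "'i set"
    and B :: "'a set" and x :: 'a and r c \<beta> S :: real
  assumes "countable I" and "I \<noteq> {}"
    and "\<And>i. i \<in> I \<Longrightarrow> compact (C i)"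
    and "\<And>i. i \<in> I \<Longrightarrow> thickness (C i) > 0"
    and "bdd_above ((\<lambda>i. diameter (C i)) ` I)"
    and "r > 0" and "B = ball x r \<or> B = cball x r"
    and "\<And>i. i \<in> I \<Longrightarrow> B \<inter> exterior (C i) = {}"
    and "0 < c" and "c < real DIM('a)"
    and "\<beta> = min (1 / 4) (diameter B / (SUP i\<in>I. diameter (C i)))"
    and "((\<lambda>i. inv_powr (thickness (C i)) c) has_sum S) I"
    and "S \<le> 1 / K2 DIM('a) * \<beta> powr c * (1 - \<beta> powr (real DIM('a) - c))"
  shows "hausdorff_dim (B \<inter> (\<Inter>i\<in>I. C i)) \<ge>
           ereal (real DIM('a) - K1 DIM('a) * (S powr (real DIM('a) / c) / (\<beta> ^ DIM('a) * \<bar>ln \<beta>\<bar>)))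
       \<and> real DIM('a) - K1 DIM('a) * (S powr (real DIM('a) / c) / (\<beta> ^ DIM('a) * \<bar>ln \<beta>\<bar>)) > 0"
proof -
  note comp = assms(3) and thick = assms(4) and r = assms(6) and B = assms(7) and BE = assms(8)
    and c = assms(9,10)
  let ?d = "DIM('a)"
  have d: "1 \<le> ?d" by simp
  define D where "D = (SUP i\<in>I. diameter (C i))"
  define Loss where "Loss = K1 ?d * (S powr (real ?d / c) / (\<beta> ^ ?d * \<bar>ln \<beta>\<bar>))"
  have cl: "closed (C i)" if "i \<in> I" for i using comp[OF that] by (rule compact_imp_closed)
  have diamD: "diameter (C i) \<le> D" if "i \<in> I" for i
    unfolding D_def by (rule cSUP_upper[OF that assms(5)])
  have diamB: "diameter B = 2 * r" using B r by auto
  \<comment> \<open>\<open>B\<close> lies in the convex hull of each set. In particular \<open>D\<close> is positive, so that \<open>\<beta>\<close> is not affected by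
    the convention for division by 0.\<close>
  have "2 * r \<le> D"
  proof -
    obtain i where i: "i \<in> I" using assms(2) by blast
    have bd: "bounded (C i)" using comp[OF i] by (rule compact_imp_bounded)
    have "diameter B \<le> diameter (C i)"
    proof (rule diameter_le)
      fix y z assume "y \<in> B" "z \<in> B"
      then have "y \<in> convex hull (C i)" "z \<in> convex hull (C i)"
        using BE[OF i] not_exterior_imp_convex_hull[OF cl[OF i]] by blast+
      then show "norm (y - z) \<le> diameter (C i)"
        using dist_convex_hull_le_diameter[OF bd] by (simp add: dist_norm)
    qed (use diameter_ge_0[OF bd] in auto)
    then show ?thesis using diamD[OF i] diamB by simp
  qed
  then have D: "0 < D" using r by simp
  have \<beta>_eq: "\<beta> = min (1 / 4) (2 * r / D)" using assms(11) diamB by (simp add: D_def)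
  have \<beta>: "0 < \<beta>" "\<beta> \<le> 1 / 4" using r D by (auto simp: \<beta>_eq)
  have D_le: "D \<le> 2 * r / \<beta>"
  proof -
    have "\<beta> \<le> 2 * r / D" by (simp add: \<beta>_eq)
    then show ?thesis using \<beta> D by (simp add: field_simps)
  qed
  have K2: "1 \<le> K2 ?d" by (rule K2_ge_1[OF d])
  have S0: "0 \<le> S"
    by (rule has_sum_nonneg[OF assms(12)]) (simp add: inv_powr_def)
  have S_le: "S \<le> \<beta> powr c / K2 ?d"
  proof -
    have "1 / K2 ?d * \<beta> powr c * (1 - \<beta> powr (real ?d - c)) \<le> 1 / K2 ?d * \<beta> powr c * 1"
      using K2 by (intro mult_left_mono) auto
    then show ?thesis using assms(13) by simp
  qed
  have S_small: "S \<le> (real ?d - c) / ?d / K2 ?d"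
    by (rule small_condition[OF d c \<beta>(1) _ S0 assms(13)]) (use \<beta> in simp)
  define \<tau> where "\<tau> i = enn2real (thickness (C i))" for i
  have gapC: "0 < \<tau> i \<and> (\<forall>G\<in>gaps (C i). \<tau> i * diameter G \<le> diameter (C i)) \<and>
      (\<forall>G\<in>gaps (C i). \<forall>G'\<in>gaps (C i). G \<noteq> G' \<longrightarrow> diameter G \<le> diameter G' \<longrightarrow> \<tau> i * diameter G \<le> setdist G G')"
    if i: "i \<in> I" and ne: "gaps (C i) \<noteq> {}" for i
  proof -
    obtain t where t: "0 < t \<and> thickness (C i) = ennreal t \<and>
        (\<forall>G\<in>gaps (C i). t * diameter G \<le> diameter (C i)) \<and>
        (\<forall>G\<in>gaps (C i). \<forall>G'\<in>gaps (C i). G \<noteq> G' \<longrightarrow> diameter G \<le> diameter G' \<longrightarrow> t * diameter G \<le> setdist G G')"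
      by (rule exE[OF thickness_gap_bounds[OF comp[OF i] thick[OF i] ne]])
    then have "\<tau> i = t" by (simp add: \<tau>_def)
    from t show ?thesis unfolding \<open>\<tau> i = t\<close> by (elim conjE) (intro conjI)
  qed
  have sum\<tau>: "((\<lambda>i. \<tau> i powr (- c)) has_sum S) I"
  proof -
    \<comment> \<open>For infinite thickness both sides are 0, as \<open>enn2real\<close> maps \<open>\<infinity>\<close> to 0 and \<open>0 powr _ = 0\<close>.\<close>
    have "inv_powr (thickness (C i)) c = \<tau> i powr (- c)" for i
      by (auto simp: inv_powr_def \<tau>_def)
    then show ?thesis using assms(12) by simp
  qed
  define s where "s = r / (2 * sqrt ?d)"
  have s: "0 < s" using r by (simp add: s_def)
  have sub: "cell x s 0 (\<lambda>b\<in>Basis. 0) - (\<Union>i\<in>I. \<Union>(gaps (C i))) \<subseteq> B \<inter> (\<Inter>i\<in>I. C i)"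
  proof
    fix y assume y: "y \<in> cell x s 0 (\<lambda>b\<in>Basis. 0) - (\<Union>i\<in>I. \<Union>(gaps (C i)))"
    have "sqrt ?d * s = r / 2" by (simp add: s_def)
    then have "y \<in> cball x (r / 2)" using y cell_0_subset_cball[OF s, of x] by auto
    then have yB: "y \<in> B" using B r by auto
    moreover have "y \<in> C i" if "i \<in> I" for i
      using not_exterior_imp_gap[of y "C i"] BE[OF that] yB y that by blast
    ultimately show "y \<in> B \<inter> (\<Inter>i\<in>I. C i)" by blast
  qed
  have start: "S * D powr c \<le> (1 / 24 * s) powr c"
    unfolding s_def by (rule start_condition[OF d c \<beta>(1) S0 S_le r _ D_le]) (use D in simp)
  have dim: "ereal (real ?d - 1 / N) \<le> hausdorff_dim (B \<inter> (\<Inter>i\<in>I. C i))"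
    if N: "(2 * real ?d + 3) / (real ?d - c) \<le> N"
      "real N * (8 * (6 * sqrt ?d) ^ ?d * S powr (?d / c)) \<le> 1" for N :: nat
  proof (rule hausdorff_dim_avoiding_gaps[OF c s _ cl _ _ _ sum\<tau> S_small start N sub])
    show "0 \<le> D" using D by simp
    show "0 < \<tau> i" if "i \<in> I" "gaps (C i) \<noteq> {}" for i using gapC[OF that] by blast
    show "\<tau> i * diameter G \<le> D" if "i \<in> I" "G \<in> gaps (C i)" for i G
      using gapC[of i] diamD[of i] that by force
    show "\<tau> i * diameter G \<le> setdist G G'"
      if "i \<in> I" "G \<in> gaps (C i)" "G' \<in> gaps (C i)" "G \<noteq> G'" "diameter G \<le> diameter G'" for i G G'
      using gapC[of i] that by blast
  qed
  have loss: "16 * (6 * sqrt ?d) ^ ?d * S powr (?d / c) \<le> Loss" "Loss < ?d"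
    unfolding Loss_def using loss_bounds[OF d c \<beta> S0 S_le] by auto
  have "ereal (real ?d - Loss) \<le> hausdorff_dim (B \<inter> (\<Inter>i\<in>I. C i))"
  proof (cases "S = 0")
    case False
    then have "0 < S" using S0 by simp
    then obtain N :: nat where N: "(2 * real ?d + 3) / (real ?d - c) \<le> N"
      "real N * (8 * (6 * sqrt ?d) ^ ?d * S powr (?d / c)) \<le> 1"
      "1 / real N \<le> 16 * (6 * sqrt ?d) ^ ?d * S powr (?d / c)"
      using exists_scale[OF d c _ S_small] by blast
    have "ereal (real ?d - Loss) \<le> ereal (real ?d - 1 / N)" using N(3) loss by simp
    then show ?thesis using dim[OF N(1,2)] by (rule order_trans)
  next
    case True
    \<comment> \<open>Here nothing bounds \<open>N\<close> from above, and \<open>N\<close> tends to infinity.\<close>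
    have "(\<lambda>n. ereal (real ?d - 1 / real n)) \<longlonglongrightarrow> ereal (real ?d - 0)"
      by (intro tendsto_intros lim_1_over_n)
    moreover have "\<forall>\<^sub>F n in sequentially. ereal (real ?d - 1 / real n) \<le> hausdorff_dim (B \<inter> (\<Inter>i\<in>I. C i))"
      using eventually_ge_at_top[of "nat \<lceil>(2 * real ?d + 3) / (real ?d - c)\<rceil>"]
      by eventually_elim (intro dim; use True in simp; linarith)
    ultimately have "ereal (real ?d - 0) \<le> hausdorff_dim (B \<inter> (\<Inter>i\<in>I. C i))"
      by (intro tendsto_upperbound) auto
    then show ?thesis using True by (simp add: Loss_def)
  qed
  then show ?thesis using loss(2) by (simp add: Loss_def)
qed

end
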